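(* For every integer $m\ge1$ with $2m-1\le n$, $$\tilde R_{(1^{2m-1})}(u;r)=\tilde P_{(1^m)}(u_{\rm odd};2r)-\tilde P_{(1^m)}(u_{\rm even};2r),$$ and for every integer $m\ge1$ with $2m\le n$, $$\tilde R_{(1^{2m})}(u;r)=\tilde P_{(1^m)}(u_{\rm even};2r).$$
   Context: Let $k$ be a field of characteristic zero, $n\ge 1$, and let $W\subseteq S_n$ be the group of permutations $\pi$ with $\pi(i)\equiv i \bmod 2$ for all $i$, acting on $k[z_1,\dots,z_n]$ by permuting variables. For $N\ge 0$, $\Lambda_N$ is the set of integer tuples $\lambda=(\lambda_1\ge\dots\ge\lambda_N\ge 0)$; $|\lambda|=\sum_i\lambda_i$ and $|\lambda|_{\rm odd}=\sum_{i\text{ odd}}\lambda_i$. Fix $r\in k$ which is not a negative rational number. For $u=(u_1,\dots,u_n)$ put $u_{\rm odd}=(u_1,u_3,\dots)$ ($\lceil n/2\rceil$ entries), $u_{\rm even}=(u_2,u_4,\dots)$ ($\lfloor n/2\rfloor$ entries). Put $\rho=((n-1)r,\dots,r,0)$ and $[\lambda]_m=\lambda_m-\lambda_{m+1}+\dots+(-1)^{n-m}\lambda_n$ for $\lambda\in\Lambda_n$. $R_\lambda(z;r)$ is the unique $W$-invariant polynomial of degree $|\lambda|_{\rm odd}$ which satisfies $R_\lambda(\rho+\mu)=0$ for all $\mu\in\Lambda_n$ with $|\mu|_{\rm odd}\le|\lambda|_{\rm odd}$, $\mu\ne\lambda$, and in which the monomial $z^{[\lambda]}$ has coefficient $1$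 (it is known that this exists and is unique). $\tilde R_\lambda(u;r)=R_\lambda(\rho+u;r)$. Shifted Jack polynomials: for a parameter $q\in k$, not a negative rational number, $\lambda\in\Lambda_N$, and $\rho^{(N)}=((N-1)q,\dots,q,0)$, $P_\lambda(z_1,\dots,z_N;q)$ is the unique $S_N$-symmetric polynomial of degree $|\lambda|$ in which $z^\lambda$ has coefficient $1$ and which satisfies $P_\lambda(\rho^{(N)}+\mu)=0$ for all $\mu\in\Lambda_N$ with $|\mu|\le|\lambda|$, $\mu\ne\lambda$ (existence and uniqueness are known). $\tilde P_\lambda(v;q)=P_\lambda(\rho^{(N)}+v;q)$ for $v=(v_1,\dots,v_N)$. Convention: $\tilde P_{(1^m)}(v;q)=0$ if $m$ exceeds the number $N$ of entries of $v$. Above, $q=2r$, and $N$ is the number of entries of $u_{\rm odd}$ or $u_{\rm even}$. $(1^m)$ denotes the partition with $m$ ones followed by zeros. *)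

theory Defs
  imports Complex_Main "HOL-Library.Poly_Mapping" "HOL-Combinatorics.Permutations"
begin

text \<open>
  Exponents and partitions are both finitely supported functions on \<open>nat\<close>, and the
  variables are \<open>z\<^sub>1, z\<^sub>2, \<dots>\<close>, so that indices (and their parities) start at 1.  The
  coefficient of \<open>z\<^sup>\<alpha>\<close> in \<open>p\<close> is \<open>Poly_Mapping.lookup p \<alpha>\<close>.
\<close>

type_synonym expo = "nat \<Rightarrow>\<^sub>0 nat"
type_synonym 'k mpoly = "expo \<Rightarrow>\<^sub>0 'k"

definition Cst :: "'k \<Rightarrow> 'k::comm_ring_1 mpoly" where
  "Cst c = Poly_Mapping.single 0 c"

definition Var :: "nat \<Rightarrow> 'k::comm_ring_1 mpoly" where
  "Var i = Poly_Mapping.single (Poly_Mapping.single i 1) 1"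

text \<open>\<open>eval_hom c f\<close> applies \<open>c\<close> to the coefficients and replaces \<open>z\<^sub>i\<close> by \<open>f i\<close>.\<close>

definition eval_hom ::
    "('k::comm_ring_1 \<Rightarrow> 'b::comm_ring_1) \<Rightarrow> (nat \<Rightarrow> 'b) \<Rightarrow> 'k mpoly \<Rightarrow> 'b" where
  "eval_hom c f p = (\<Sum>\<alpha>\<in>Poly_Mapping.keys p. c (Poly_Mapping.lookup p \<alpha>) *
     (\<Prod>i\<in>Poly_Mapping.keys \<alpha>. f i ^ Poly_Mapping.lookup \<alpha> i))"

definition eval :: "(nat \<Rightarrow> 'k) \<Rightarrow> 'k::comm_ring_1 mpoly \<Rightarrow> 'k" where
  "eval x p = eval_hom (\<lambda>a. a) x p"

definition subst :: "(nat \<Rightarrow> 'k mpoly) \<Rightarrow> 'k::comm_ring_1 mpoly \<Rightarrow> 'k mpoly" where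
  "subst f p = eval_hom Cst f p"

definition poly_ring :: "nat \<Rightarrow> 'k::comm_ring_1 mpoly set" where
  "poly_ring n = {p. \<forall>\<alpha>\<in>Poly_Mapping.keys p. Poly_Mapping.keys \<alpha> \<subseteq> {1..n}}"

definition total_degree :: "'k::comm_ring_1 mpoly \<Rightarrow> nat" where
  "total_degree p = Max (insert 0
     ((\<lambda>\<alpha>. \<Sum>i\<in>Poly_Mapping.keys \<alpha>. Poly_Mapping.lookup \<alpha> i) ` Poly_Mapping.keys p))"

definition invariant_under :: "(nat \<Rightarrow> nat) set \<Rightarrow> 'k::comm_ring_1 mpoly \<Rightarrow> bool" where
  "invariant_under G p \<longleftrightarrow> (\<forall>\<pi>\<in>G. subst (\<lambda>i. Var (\<pi> i)) p = p)"

definition Sym_grp :: "nat \<Rightarrow> (nat \<Rightarrow> nat) set" where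
  "Sym_grp n = {\<pi>. \<pi> permutes {1..n}}"

definition W_grp :: "nat \<Rightarrow> (nat \<Rightarrow> nat) set" where
  "W_grp n = {\<pi> \<in> Sym_grp n. \<forall>i\<in>{1..n}. \<pi> i mod 2 = i mod 2}"

definition Lam :: "nat \<Rightarrow> expo set" where
  "Lam N = {l. Poly_Mapping.keys l \<subseteq> {1..N} \<and>
     (\<forall>i j. 1 \<le> i \<and> i \<le> j \<and> j \<le> N \<longrightarrow> Poly_Mapping.lookup l j \<le> Poly_Mapping.lookup l i)}"

definition size_all :: "expo \<Rightarrow> nat" where
  "size_all l = (\<Sum>i\<in>Poly_Mapping.keys l. Poly_Mapping.lookup l i)"

definition size_odd :: "expo \<Rightarrow> nat" where
  "size_odd l = (\<Sum>i | i \<in> Poly_Mapping.keys l \<and> odd i. Poly_Mapping.lookup l i)"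

definition column :: "nat \<Rightarrow> expo" where
  "column m = (\<Sum>i\<in>{1..m}. Poly_Mapping.single i 1)"

text \<open>For \<open>l \<in> Lam n\<close> the alternating sums are nonnegative, so \<open>nat\<close> does not truncate.\<close>

definition bracket :: "nat \<Rightarrow> expo \<Rightarrow> expo" where
  "bracket n l = (\<Sum>m\<in>{1..n}. Poly_Mapping.single m
     (nat (\<Sum>j\<in>{m..n}. (- 1) ^ (j - m) * int (Poly_Mapping.lookup l j))))"

definition rho :: "nat \<Rightarrow> 'k \<Rightarrow> nat \<Rightarrow> 'k::comm_ring_1" where
  "rho n r i = of_nat (n - i) * r"

definition eval_rho :: "nat \<Rightarrow> 'k \<Rightarrow> expo \<Rightarrow> 'k::comm_ring_1 mpoly \<Rightarrow> 'k" where
  "eval_rho n r \<mu> p = eval (\<lambda>i. rho n r i + of_nat (Poly_Mapping.lookup \<mu> i)) p"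

definition shift_rho :: "nat \<Rightarrow> 'k \<Rightarrow> 'k::comm_ring_1 mpoly \<Rightarrow> 'k mpoly" where
  "shift_rho n r p = subst (\<lambda>i. Cst (rho n r i) + Var i) p"

definition semi_jack :: "nat \<Rightarrow> expo \<Rightarrow> 'k \<Rightarrow> 'k::field_char_0 mpoly" where
  "semi_jack n l r = (THE p. p \<in> poly_ring n \<and> invariant_under (W_grp n) p \<and>
     total_degree p = size_odd l \<and>
     (\<forall>\<mu>\<in>Lam n. size_odd \<mu> \<le> size_odd l \<and> \<mu> \<noteq> l \<longrightarrow> eval_rho n r \<mu> p = 0) \<and>
     Poly_Mapping.lookup p (bracket n l) = 1)"

definition semi_jack_tilde :: "nat \<Rightarrow> expo \<Rightarrow> 'k \<Rightarrow> 'k::field_char_0 mpoly" where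
  "semi_jack_tilde n l r = shift_rho n r (semi_jack n l r)"

definition shifted_jack :: "nat \<Rightarrow> expo \<Rightarrow> 'k \<Rightarrow> 'k::field_char_0 mpoly" where
  "shifted_jack N l q = (THE p. p \<in> poly_ring N \<and> invariant_under (Sym_grp N) p \<and>
     total_degree p = size_all l \<and>
     (\<forall>\<mu>\<in>Lam N. size_all \<mu> \<le> size_all l \<and> \<mu> \<noteq> l \<longrightarrow> eval_rho N q \<mu> p = 0) \<and>
     Poly_Mapping.lookup p l = 1)"

text \<open>\<open>column m \<in> Lam N\<close> iff \<open>m \<le> N\<close>; the value 0 for longer columns is a convention.\<close>

definition shifted_jack_tilde :: "nat \<Rightarrow> expo \<Rightarrow> 'k \<Rightarrow> 'k::field_char_0 mpoly" where
  "shifted_jack_tilde N l q =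
     (if l \<in> Lam N then shift_rho N q (shifted_jack N l q) else 0)"

text \<open>
  A polynomial \<open>p(v\<^sub>1, v\<^sub>2, \<dots>)\<close> read as \<open>p(u\<^sub>1, u\<^sub>3, \<dots>)\<close> or \<open>p(u\<^sub>2, u\<^sub>4, \<dots>)\<close>;
  for \<open>u = (u\<^sub>1, \<dots>, u\<^sub>n)\<close> there are \<open>(n + 1) div 2\<close> or \<open>n div 2\<close> entries.
\<close>

definition at_odd :: "'k::comm_ring_1 mpoly \<Rightarrow> 'k mpoly" where
  "at_odd p = subst (\<lambda>i. Var (2 * i - 1)) p"

definition at_even :: "'k::comm_ring_1 mpoly \<Rightarrow> 'k mpoly" where
  "at_even p = subst (\<lambda>i. Var (2 * i)) p"

definition negative_rational :: "'k::field_char_0 \<Rightarrow> bool" where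
  "negative_rational x \<longleftrightarrow> (\<exists>a::rat. a < 0 \<and> x = of_rat a)"

end

theory Submission
  imports Defs
begin

text \<open>
  Both families of polynomials are interpolation polynomials: they are pinned down by invariance,
  degree, zeros at shifted partitions \<open>\<rho> + \<mu>\<close> and one normalised coefficient.  So the two identities
  follow once explicit polynomials are seen to satisfy these conditions and the conditions are
  seen to have at most one solution.

  For uniqueness, the groups \<open>S\<^sub>n\<close> and \<open>W\<close> are the cases \<open>s = 1\<close> and \<open>s = 2\<close> of the group of
  permutations of \<open>{1..n}\<close> that preserve residues modulo \<open>s\<close>, and the two sizes \<open>|\<mu>|\<close> and \<open>|\<mu>|\<^sub>o\<^sub>d\<^sub>d\<close>
  are the sums of the \<open>\<mu>\<^sub>i\<close> with \<open>i \<equiv> 1 (mod s)\<close>.  An invariant polynomial of degree at most \<open>d\<close>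
  that vanishes at \<open>\<rho> + \<mu>\<close> for all \<open>\<mu>\<close> of size at most \<open>d\<close> is zero
  (\<open>vanishing_on_small_partitions\<close>): as \<open>\<rho>\<^sub>n = 0\<close>, setting \<open>z\<^sub>n = 0\<close> gives the same situation in
  \<open>n - 1\<close> variables, so \<open>z\<^sub>n\<close> divides the polynomial, and by invariance so does the product of all
  \<open>z\<^sub>i\<close> with \<open>i \<equiv> n\<close>.  That product has as many factors as there are \<open>i \<equiv> 1\<close> in \<open>{1..n}\<close>, which
  is the size lost by a partition when \<open>1\<close> is subtracted from all its \<open>n\<close> parts; so the quotient,
  shifted by \<open>1\<close>, satisfies the hypotheses for a smaller \<open>d\<close>.  Two interpolation polynomials for the
  same \<open>\<lambda>\<close> are then proportional, and their normalisation makes them equal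
  (\<open>interpolates_unique\<close>).

  The explicit polynomials come from
  \<open>E\<^sub>m(x) = \<Sum> \<Prod>\<^sub>j (x\<^bsub>i_j\<^esub> + (m - j) q)\<close>, summed over \<open>i_1 < \<dots> < i_m\<close>.  If \<open>x\<close> has fewer
  than \<open>m\<close> nonzero entries, all at the front, then the last factor of every term is zero; and
  \<open>E\<^sub>m\<close> is symmetric in the coordinates \<open>z = \<rho> + x\<close> (\<open>sym_elem_cong_mset\<close>).  On a partition of
  size at most \<open>m\<close> these zeros suffice, since the only such partitions with a nonzero entry at
  position \<open>s(m - 1) + 1\<close> are columns (\<open>small_partition_is_column\<close>).  For \<open>s = 1\<close> this identifies the
  shifted Jack polynomial of \<open>(1\<^sup>m)\<close> with \<open>E\<^sub>m\<close>.  For \<open>s = 2\<close> one takes \<open>q = 2r\<close>, because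
  \<open>\<rho>\<close> restricted to one parity class has steps \<open>2r\<close>: then \<open>E\<^sub>m(u\<^sub>e\<^sub>v\<^sub>e\<^sub>n)\<close> has the zeros required for
  \<open>(1\<^bsup>2m\<^esup>)\<close>, and \<open>E\<^sub>m(u\<^sub>o\<^sub>d\<^sub>d) - E\<^sub>m(u\<^sub>e\<^sub>v\<^sub>e\<^sub>n)\<close> those for \<open>(1\<^bsup>2m-1\<^esup>)\<close>.  In the latter case each term
  alone has all the required zeros except that at \<open>(1\<^bsup>2m\<^esup>)\<close>, where both take the value of \<open>E\<^sub>m\<close> at
  \<open>(1, \<dots>, 1)\<close>, because \<open>E\<^sub>m\<close> does not change when zeros are appended to its argument.
\<close>

abbreviation (input) "lookup \<equiv> Poly_Mapping.lookup"
abbreviation (input) "keys \<equiv> Poly_Mapping.keys"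

section \<open>Polynomial substitution as a ring homomorphism\<close>

definition ring_map :: "('a::comm_ring_1 \<Rightarrow> 'b::comm_ring_1) \<Rightarrow> bool" where
  "ring_map h \<longleftrightarrow> h 1 = 1 \<and> (\<forall>a b. h (a + b) = h a + h b) \<and> (\<forall>a b. h (a * b) = h a * h b)"

lemma ring_map_one: "ring_map h \<Longrightarrow> h 1 = 1"
  and ring_map_add: "ring_map h \<Longrightarrow> h (a + b) = h a + h b"
  and ring_map_mult: "ring_map h \<Longrightarrow> h (a * b) = h a * h b"
  by (auto simp: ring_map_def)

lemma ring_map_zero: "ring_map h \<Longrightarrow> h 0 = 0"
  using ring_map_add[of h 0 0] by simp

lemma ring_map_diff: "ring_map h \<Longrightarrow> h (a - b) = h a - h b"
  using ring_map_add[of h "a - b" b] by (simp add: algebra_simps)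

lemma ring_map_of_nat: "ring_map h \<Longrightarrow> h (of_nat k) = of_nat k"
  by (induction k) (simp_all add: ring_map_zero ring_map_one ring_map_add)

lemma ring_map_power: "ring_map h \<Longrightarrow> h (a ^ k) = h a ^ k"
  by (induction k) (simp_all add: ring_map_one ring_map_mult)

lemma ring_map_prod: "ring_map h \<Longrightarrow> h (prod f A) = (\<Prod>i\<in>A. h (f i))"
  by (induction A rule: infinite_finite_induct) (simp_all add: ring_map_one ring_map_mult)

lemma ring_map_comp: "ring_map g \<Longrightarrow> ring_map h \<Longrightarrow> ring_map (\<lambda>p. g (h p))"
  by (simp add: ring_map_def)

lemma ring_map_ident: "ring_map (\<lambda>a. a)"
  by (simp add: ring_map_def)

lemmas ring_map_simps = ring_map_zero ring_map_one ring_map_add ring_map_mult ring_map_diff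
  ring_map_of_nat ring_map_power ring_map_prod

lemma ring_map_Cst: "ring_map Cst"
  by (simp add: ring_map_def Cst_def single_add mult_single)

lemma poly_mapping_single_induct [case_names zero add]:
  fixes p :: "'a \<Rightarrow>\<^sub>0 'b::comm_monoid_add"
  assumes "P 0" "\<And>p \<alpha> c. P p \<Longrightarrow> P (p + Poly_Mapping.single \<alpha> c)"
  shows "P p"
proof (induction p rule: update_induct)
  case const
  show ?case by (rule assms(1))
next
  case (update f a b)
  have "Poly_Mapping.update a b f = f + Poly_Mapping.single a b"
    using update(1)
    by (intro poly_mapping_eqI) (auto simp: lookup_update lookup_add lookup_single in_keys_iff when_def)
  then show ?case using assms(2)[OF update(3)] by simp
qed

definition monom_at :: "(nat \<Rightarrow> 'b::comm_ring_1) \<Rightarrow> expo \<Rightarrow> 'b" where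
  "monom_at f \<alpha> = (\<Prod>i\<in>keys \<alpha>. f i ^ lookup \<alpha> i)"

lemma monom_at_superset:
  assumes "finite S" "keys \<alpha> \<subseteq> S"
  shows "monom_at f \<alpha> = (\<Prod>i\<in>S. f i ^ lookup \<alpha> i)"
  unfolding monom_at_def using assms
  by (intro prod.mono_neutral_left) (auto simp: in_keys_iff)

lemma monom_at_add: "monom_at f (\<alpha> + \<beta>) = monom_at f \<alpha> * monom_at f \<beta>"
proof -
  let ?S = "keys \<alpha> \<union> keys \<beta>"
  have "monom_at f (\<alpha> + \<beta>) = (\<Prod>i\<in>?S. f i ^ lookup (\<alpha> + \<beta>) i)"
    by (rule monom_at_superset) (auto simp: keys_add)
  also have "\<dots> = (\<Prod>i\<in>?S. f i ^ lookup \<alpha> i) * (\<Prod>i\<in>?S. f i ^ lookup \<beta> i)"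
    by (simp add: lookup_add power_add prod.distrib)
  also have "\<dots> = monom_at f \<alpha> * monom_at f \<beta>"
    by (simp add: monom_at_superset[symmetric])
  finally show ?thesis .
qed

lemma monom_at_single [simp]: "monom_at f (Poly_Mapping.single i k) = f i ^ k"
  by (simp add: monom_at_def)

lemma monom_at_zero [simp]: "monom_at f 0 = 1"
  by (simp add: monom_at_def)

lemma eval_hom_alt: "eval_hom c f p = (\<Sum>\<alpha>\<in>keys p. c (lookup p \<alpha>) * monom_at f \<alpha>)"
  by (simp add: eval_hom_def monom_at_def)

lemma eval_hom_superset:
  assumes "ring_map c" "finite S" "keys p \<subseteq> S"
  shows "eval_hom c f p = (\<Sum>\<alpha>\<in>S. c (lookup p \<alpha>) * monom_at f \<alpha>)"
  unfolding eval_hom_alt using assms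
  by (intro sum.mono_neutral_left) (auto simp: in_keys_iff ring_map_zero)

lemma eval_hom_single: "ring_map c \<Longrightarrow> eval_hom c f (Poly_Mapping.single \<alpha> a) = c a * monom_at f \<alpha>"
  by (simp add: eval_hom_alt ring_map_zero)

lemma eval_hom_add:
  assumes "ring_map c"
  shows "eval_hom c f (p + q) = eval_hom c f p + eval_hom c f q"
proof -
  let ?S = "keys p \<union> keys q"
  have "eval_hom c f (p + q) = (\<Sum>\<alpha>\<in>?S. c (lookup (p + q) \<alpha>) * monom_at f \<alpha>)"
    by (rule eval_hom_superset[OF assms]) (auto simp: keys_add)
  also have "\<dots> = (\<Sum>\<alpha>\<in>?S. c (lookup p \<alpha>) * monom_at f \<alpha>) + (\<Sum>\<alpha>\<in>?S. c (lookup q \<alpha>) * monom_at f \<alpha>)"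
    by (simp add: lookup_add ring_map_add[OF assms] algebra_simps sum.distrib)
  also have "\<dots> = eval_hom c f p + eval_hom c f q"
    by (simp add: eval_hom_superset[OF assms, symmetric])
  finally show ?thesis .
qed

lemma ring_map_eval_hom:
  assumes "ring_map c"
  shows "ring_map (eval_hom c f)"
proof -
  have one: "eval_hom c f 1 = 1"
    using eval_hom_single[OF assms, of f 0 1] by (simp add: ring_map_one[OF assms])
  have zero: "eval_hom c f 0 = 0" by (simp add: eval_hom_def)
  have single: "eval_hom c f (Poly_Mapping.single \<alpha> a * q)
      = eval_hom c f (Poly_Mapping.single \<alpha> a) * eval_hom c f q" for \<alpha> a q
    by (induction q rule: poly_mapping_single_induct)
      (simp_all add: zero distrib_left eval_hom_add[OF assms] mult_single eval_hom_single[OF assms]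
        monom_at_add ring_map_mult[OF assms])
  have "eval_hom c f (p * q) = eval_hom c f p * eval_hom c f q" for p q
    by (induction p rule: poly_mapping_single_induct)
      (simp_all add: zero distrib_right eval_hom_add[OF assms] single)
  with one show ?thesis by (simp add: ring_map_def eval_hom_add[OF assms])
qed

lemma eval_hom_Cst [simp]: "ring_map c \<Longrightarrow> eval_hom c f (Cst a) = c a"
  by (simp add: Cst_def eval_hom_single)

lemma eval_hom_Var [simp]: "ring_map c \<Longrightarrow> eval_hom c f (Var i) = f i"
  by (simp add: Var_def eval_hom_single ring_map_one)

lemma ring_map_subst: "ring_map (subst f)"
  and ring_map_eval: "ring_map (eval x)"
  using ring_map_eval_hom[OF ring_map_Cst] ring_map_eval_hom[OF ring_map_ident]
  by (simp_all add: ring_map_def subst_def eval_def)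

lemma subst_Cst [simp]: "subst f (Cst a) = Cst a"
  and subst_Var [simp]: "subst f (Var i) = f i"
  and eval_Cst [simp]: "eval x (Cst a) = a"
  and eval_Var [simp]: "eval x (Var i) = x i"
  by (simp_all add: subst_def eval_def ring_map_Cst ring_map_ident)

lemmas subst_simps = ring_map_simps[OF ring_map_subst]
lemmas eval_simps = ring_map_simps[OF ring_map_eval]
lemmas Cst_simps = ring_map_simps[OF ring_map_Cst]

definition vars :: "'k::comm_ring_1 mpoly \<Rightarrow> nat set" where
  "vars p = (\<Union>\<alpha>\<in>keys p. keys \<alpha>)"

lemma poly_ring_iff: "p \<in> poly_ring n \<longleftrightarrow> vars p \<subseteq> {1..n}"
  by (auto simp: poly_ring_def vars_def)

lemma Var_power: "Var i ^ k = Poly_Mapping.single (Poly_Mapping.single i k) 1"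
  by (induction k) (simp_all add: Var_def mult_single single_add[symmetric])

lemma prod_single_one:
  "(\<Prod>i\<in>A. Poly_Mapping.single (g i) (1::'k::comm_ring_1)) = Poly_Mapping.single (\<Sum>i\<in>A. g i) 1"
  by (induction A rule: infinite_finite_induct) (simp_all add: mult_single)

lemma poly_mapping_sum_single: "(\<Sum>i\<in>keys \<alpha>. Poly_Mapping.single i (lookup \<alpha> i)) = \<alpha>"
  by (rule poly_mapping_eqI) (auto simp: lookup_sum lookup_single when_def in_keys_iff sum.delta)

lemma single_eq_Cst_times_monom: "Poly_Mapping.single \<alpha> c = Cst c * monom_at Var \<alpha>"
  by (simp add: monom_at_def Var_power prod_single_one poly_mapping_sum_single Cst_def mult_single)

lemma ring_map_eq_eval_hom:
  assumes "ring_map h"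
  shows "h p = eval_hom (\<lambda>a. h (Cst a)) (\<lambda>i. h (Var i)) p"
proof (induction p rule: poly_mapping_single_induct)
  case zero
  show ?case by (simp add: eval_hom_def ring_map_zero[OF assms])
next
  case (add p \<alpha> c)
  have c: "ring_map (\<lambda>a. h (Cst a))" by (rule ring_map_comp[OF assms ring_map_Cst])
  have "h (Poly_Mapping.single \<alpha> c) = h (Cst c) * monom_at (\<lambda>i. h (Var i)) \<alpha>"
    by (simp add: single_eq_Cst_times_monom monom_at_def ring_map_mult[OF assms]
        ring_map_prod[OF assms] ring_map_power[OF assms])
  with add show ?case
    by (simp add: eval_hom_add[OF c] eval_hom_single[OF c] ring_map_add[OF assms])
qed

text \<open>Polynomials are generated by constants and variables.  Hence an identity between composed
  substitutions and evaluations needs to be compared only on the variables that occur.\<close>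

lemma ring_map_eqI:
  assumes "ring_map g" "ring_map h" "\<And>a. g (Cst a) = h (Cst a)"
    "\<And>i. i \<in> vars p \<Longrightarrow> g (Var i) = h (Var i)"
  shows "g p = h p"
proof -
  have "g p = eval_hom (\<lambda>a. h (Cst a)) (\<lambda>i. g (Var i)) p"
    using ring_map_eq_eval_hom[OF assms(1), of p] assms(3) by simp
  also have "\<dots> = eval_hom (\<lambda>a. h (Cst a)) (\<lambda>i. h (Var i)) p"
    unfolding eval_hom_def
    by (intro sum.cong prod.cong arg_cong2[where f = "(*)"] arg_cong2[where f = "(^)"] assms(4))
      (auto simp: vars_def)
  also have "\<dots> = h p" using ring_map_eq_eval_hom[OF assms(2), of p] by simp
  finally show ?thesis .
qed

lemma subst_subst: "subst f (subst g p) = subst (\<lambda>i. subst f (g i)) p"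
  by (rule ring_map_eqI[OF ring_map_comp[OF ring_map_subst ring_map_subst] ring_map_subst]) simp_all

lemma eval_subst: "eval x (subst g p) = eval (\<lambda>i. eval x (g i)) p"
  by (rule ring_map_eqI[OF ring_map_comp[OF ring_map_eval ring_map_subst] ring_map_eval]) simp_all

lemma subst_cong: "(\<And>i. i \<in> vars p \<Longrightarrow> f i = g i) \<Longrightarrow> subst f p = subst g p"
  by (rule ring_map_eqI[OF ring_map_subst ring_map_subst]) simp_all

lemma eval_cong: "(\<And>i. i \<in> vars p \<Longrightarrow> x i = y i) \<Longrightarrow> eval x p = eval y p"
  by (rule ring_map_eqI[OF ring_map_eval ring_map_eval]) simp_all

lemma subst_Var_id [simp]: "subst Var p = p"
  by (rule ring_map_eqI[OF ring_map_subst ring_map_ident]) simp_all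

section \<open>Variables and degree\<close>

lemma vars_Cst [simp]: "vars (Cst c) = {}"
  by (auto simp: vars_def Cst_def)

lemma vars_Var [simp]: "vars (Var i :: 'k::comm_ring_1 mpoly) = {i}"
  by (auto simp: vars_def Var_def)

lemma vars_add: "vars (p + q) \<subseteq> vars p \<union> vars q"
  using keys_add[of p q] by (auto simp: vars_def)

lemma vars_diff: "vars (p - q) \<subseteq> vars p \<union> vars q"
  using keys_diff[of p q] by (auto simp: vars_def)

lemma vars_mult: "vars (p * q) \<subseteq> vars p \<union> vars q"
proof
  fix i assume "i \<in> vars (p * q)"
  then obtain \<gamma> where \<gamma>: "\<gamma> \<in> keys (p * q)" "i \<in> keys \<gamma>" unfolding vars_def by blast
  then obtain a b where ab: "\<gamma> = a + b" "a \<in> keys p" "b \<in> keys q" using keys_mult[of p q] by blast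
  then have "i \<in> keys a \<union> keys b" using \<gamma>(2) keys_add[of a b] by blast
  then show "i \<in> vars p \<union> vars q" using ab unfolding vars_def by blast
qed

lemma vars_zero [simp]: "vars 0 = {}"
  and vars_one [simp]: "vars 1 = {}"
  by (simp_all add: vars_def)

lemma vars_sum: "vars (sum f A) \<subseteq> (\<Union>i\<in>A. vars (f i))"
proof (induction A rule: infinite_finite_induct)
  case (insert a A)
  have "vars (f a + sum f A) \<subseteq> vars (f a) \<union> (\<Union>i\<in>A. vars (f i))"
    using vars_add[of "f a" "sum f A"] insert(3) by blast
  with insert show ?case by simp
qed simp_all

lemma vars_power: "vars (p ^ k) \<subseteq> vars p"
proof (induction k)
  case (Suc k)
  have "vars (p * p ^ k) \<subseteq> vars p" using vars_mult[of p "p ^ k"] Suc by blast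
  then show ?case by simp
qed simp

lemma vars_prod: "vars (prod f A) \<subseteq> (\<Union>i\<in>A. vars (f i))"
proof (induction A rule: infinite_finite_induct)
  case (insert a A)
  have "vars (f a * prod f A) \<subseteq> vars (f a) \<union> (\<Union>i\<in>A. vars (f i))"
    using vars_mult[of "f a" "prod f A"] insert(3) by blast
  with insert show ?case by simp
qed simp_all

lemma vars_subst: "vars (subst f p) \<subseteq> (\<Union>i\<in>vars p. vars (f i))"
proof -
  have "vars (subst f p) \<subseteq> (\<Union>\<alpha>\<in>keys p. vars (Cst (lookup p \<alpha>) * monom_at f \<alpha>))"
    unfolding subst_def eval_hom_alt by (rule vars_sum)
  also have "\<dots> \<subseteq> (\<Union>\<alpha>\<in>keys p. \<Union>i\<in>keys \<alpha>. vars (f i))"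
  proof (intro UN_mono order_refl)
    fix \<alpha>
    have "vars (monom_at f \<alpha>) \<subseteq> (\<Union>i\<in>keys \<alpha>. vars (f i))"
      unfolding monom_at_def by (rule order_trans[OF vars_prod UN_mono[OF order_refl vars_power]])
    then show "vars (Cst (lookup p \<alpha>) * monom_at f \<alpha>) \<subseteq> (\<Union>i\<in>keys \<alpha>. vars (f i))"
      using vars_mult[of "Cst (lookup p \<alpha>)" "monom_at f \<alpha>"] unfolding vars_Cst by blast
  qed
  also have "\<dots> = (\<Union>i\<in>vars p. vars (f i))" unfolding vars_def[of p] by blast
  finally show ?thesis .
qed

lemma size_all_superset: "finite S \<Longrightarrow> keys \<alpha> \<subseteq> S \<Longrightarrow> size_all \<alpha> = (\<Sum>i\<in>S. lookup \<alpha> i)"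
  unfolding size_all_def by (intro sum.mono_neutral_left) (auto simp: in_keys_iff)

lemma size_all_add: "size_all (\<alpha> + \<beta>) = size_all \<alpha> + size_all \<beta>"
  using size_all_superset[of "keys \<alpha> \<union> keys \<beta>"] keys_add[of \<alpha> \<beta>]
  by (simp add: lookup_add sum.distrib)

lemma total_degree_le_iff: "total_degree p \<le> d \<longleftrightarrow> (\<forall>\<alpha>\<in>keys p. size_all \<alpha> \<le> d)"
  by (auto simp: total_degree_def size_all_def)

lemma degree_le_add: "total_degree p \<le> d \<Longrightarrow> total_degree q \<le> d \<Longrightarrow> total_degree (p + q) \<le> d"
  using keys_add[of p q] by (auto simp: total_degree_le_iff)

lemma degree_le_diff: "total_degree p \<le> d \<Longrightarrow> total_degree q \<le> d \<Longrightarrow> total_degree (p - q) \<le> d"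
  using keys_diff[of p q] by (auto simp: total_degree_le_iff)

lemma degree_le_mult:
  assumes "total_degree p \<le> d" "total_degree q \<le> e"
  shows "total_degree (p * q) \<le> d + e"
  unfolding total_degree_le_iff
proof
  fix \<gamma> assume "\<gamma> \<in> keys (p * q)"
  then obtain a b where "\<gamma> = a + b" "a \<in> keys p" "b \<in> keys q" using keys_mult by fast
  then show "size_all \<gamma> \<le> d + e"
    using assms by (auto simp: total_degree_le_iff size_all_add intro!: add_mono)
qed

lemma degree_Cst [simp]: "total_degree (Cst c) = 0"
  by (simp add: total_degree_def Cst_def)

lemma degree_one [simp]: "total_degree (1 :: 'k::comm_ring_1 mpoly) = 0"
  by (simp add: total_degree_def)

lemma degree_le_zero: "total_degree (0 :: 'k::comm_ring_1 mpoly) \<le> d"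
  by (simp add: total_degree_le_iff)

lemma degree_le_Var: "total_degree (Var i :: 'k::comm_ring_1 mpoly) \<le> 1"
  by (simp add: total_degree_le_iff Var_def size_all_def)

lemma degree_le_sum: "(\<And>i. i \<in> A \<Longrightarrow> total_degree (f i) \<le> d) \<Longrightarrow> total_degree (sum f A) \<le> d"
  by (induction A rule: infinite_finite_induct) (simp_all add: degree_le_zero degree_le_add)

lemma degree_le_power: "total_degree p \<le> 1 \<Longrightarrow> total_degree (p ^ k) \<le> k"
proof (induction k)
  case (Suc k)
  then show ?case using degree_le_mult[of p 1 "p ^ k" k] by simp
qed (simp add: degree_one)

lemma degree_le_prod:
  "(\<And>i. i \<in> A \<Longrightarrow> total_degree (f i) \<le> g i) \<Longrightarrow> total_degree (prod f A) \<le> sum g A"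
  by (induction A rule: infinite_finite_induct) (simp_all add: degree_one degree_le_mult)

lemma degree_le_subst:
  assumes "\<And>i. total_degree (f i) \<le> 1" "total_degree p \<le> d"
  shows "total_degree (subst f p) \<le> d"
  unfolding subst_def eval_hom_alt
proof (rule degree_le_sum)
  fix \<alpha> assume "\<alpha> \<in> keys p"
  then have "size_all \<alpha> \<le> d" using assms(2) by (simp add: total_degree_le_iff)
  moreover have "total_degree (monom_at f \<alpha>) \<le> size_all \<alpha>"
    unfolding monom_at_def size_all_def by (intro degree_le_prod degree_le_power assms(1))
  ultimately show "total_degree (Cst (lookup p \<alpha>) * monom_at f \<alpha>) \<le> d"
    using degree_le_mult[of "Cst (lookup p \<alpha>)" 0 "monom_at f \<alpha>" d] by simp
qed

lemma degree_le_affine: "total_degree (Var i + Cst c) \<le> 1"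
  by (intro degree_le_add degree_le_Var) simp

section \<open>Elementary symmetric polynomials with shifted factors\<close>

text \<open>This is the sum over \<open>i_1 < \<dots> < i_m\<close> of the products of the \<open>x\<^bsub>i_j\<^esub> + (m - j) q\<close>; the two
  summands of the recursion collect the index sets without and with the first position.\<close>

fun shifted_elem :: "'b::comm_ring_1 \<Rightarrow> nat \<Rightarrow> 'b list \<Rightarrow> 'b" where
  "shifted_elem q 0 xs = 1"
| "shifted_elem q (Suc m) [] = 0"
| "shifted_elem q (Suc m) (x # xs) =
     shifted_elem q (Suc m) xs + (x + of_nat m * q) * shifted_elem q m xs"

text \<open>The same polynomial in the coordinates \<open>z_i = (N - i) q + x_i\<close>, where \<open>N\<close> is the length of
  the list.  For the head of the list, \<open>N - 1\<close> is the length of the tail.\<close>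

fun sym_elem :: "'b::comm_ring_1 \<Rightarrow> nat \<Rightarrow> 'b list \<Rightarrow> 'b" where
  "sym_elem q 0 zs = 1"
| "sym_elem q (Suc m) [] = 0"
| "sym_elem q (Suc m) (z # zs) =
     sym_elem q (Suc m) zs + (z - (of_nat (length zs) - of_nat m) * q) * sym_elem q m zs"

lemma sym_elem_add_rho_upt:
  "sym_elem q m (map (\<lambda>i. of_nat (N - i) * q + x i) [k..<Suc N])
     = shifted_elem q m (map x [k..<Suc N])"
proof (induction "Suc N - k" arbitrary: k m)
  case 0
  then show ?case by (cases m) simp_all
next
  case (Suc d)
  then have "k < Suc N" by simp
  then have k: "[k..<Suc N] = k # [Suc k..<Suc N]" by (rule upt_conv_Cons)
  have "d = Suc N - Suc k" using Suc(2) by simp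
  note IH = Suc(1)[OF this]
  show ?case
  proof (cases m)
    case (Suc m')
    have "length [Suc k..<Suc N] = N - k" by (simp del: upt_Suc)
    then show ?thesis unfolding k Suc list.map sym_elem.simps shifted_elem.simps IH length_map
      by (simp only: algebra_simps)
  qed simp
qed

text \<open>Expanding both heads, the coefficient of the lower polynomial with two factors fewer is
  \<open>(a - c q) (b - c q)\<close> with the same \<open>c\<close> in both factors, and that of the one with one factor fewer
  depends on \<open>a\<close> and \<open>b\<close> only through \<open>a + b\<close>.\<close>

lemma sym_elem_swap: "sym_elem q m (a # b # zs) = sym_elem q m (b # a # zs)"
proof (cases m)
  case (Suc k)
  then show ?thesis by (cases k) (simp_all add: algebra_simps)
qed simp

lemma sym_elem_Cons_cong:
  assumes "\<And>m. sym_elem q m xs = sym_elem q m ys" "length xs = length ys"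
  shows "sym_elem q m (a # xs) = sym_elem q m (a # ys)"
  by (cases m) (simp_all add: assms)

lemma sym_elem_move_to_front: "sym_elem q m (ys @ a # zs) = sym_elem q m (a # ys @ zs)"
proof (induction ys arbitrary: m)
  case (Cons y ys)
  have "sym_elem q m (y # ys @ a # zs) = sym_elem q m (y # a # ys @ zs)"
    by (rule sym_elem_Cons_cong[OF Cons]) simp
  then show ?case by (simp only: append_Cons sym_elem_swap[of q m y])
qed simp

text \<open>Invariance under adjacent swaps at the head propagates along the list and gives full
  symmetry.  Stated with multisets, it applies to any rearrangement of the variables.\<close>

lemma sym_elem_cong_mset: "mset xs = mset ys \<Longrightarrow> sym_elem q m xs = sym_elem q m ys"
proof (induction xs arbitrary: ys m)
  case (Cons x xs)
  then have "x \<in> set ys" by (metis list.set_intros(1) mset_eq_setD)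
  then obtain us vs where ys: "ys = us @ x # vs" by (meson split_list)
  then have *: "mset xs = mset (us @ vs)" using Cons.prems by simp
  have "sym_elem q m (x # xs) = sym_elem q m (x # us @ vs)"
    using Cons.IH[OF *] mset_eq_length[OF *] by (rule sym_elem_Cons_cong)
  then show ?case by (simp only: ys sym_elem_move_to_front)
qed simp

lemma ring_map_sym_elem:
  assumes "ring_map h"
  shows "h (sym_elem q m zs) = sym_elem (h q) m (map h zs)"
  by (induction q m zs rule: sym_elem.induct) (simp_all add: ring_map_simps[OF assms])

lemma ring_map_shifted_elem:
  assumes "ring_map h"
  shows "h (shifted_elem q m xs) = shifted_elem (h q) m (map h xs)"
  by (induction q m xs rule: shifted_elem.induct) (simp_all add: ring_map_simps[OF assms])

lemma shifted_elem_too_long: "length xs < m \<Longrightarrow> shifted_elem q m xs = 0"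
  by (induction q m xs rule: shifted_elem.induct) simp_all

text \<open>An index set that contains the new last position has it as its largest element, so the
  corresponding factor is the new entry itself, without a shift.\<close>

lemma shifted_elem_append_zero: "shifted_elem q m (xs @ [0]) = shifted_elem q m xs"
proof (induction q m xs rule: shifted_elem.induct)
  case (2 q m)
  then show ?case by (cases m) simp_all
qed simp_all

lemma shifted_elem_append_zeros: "shifted_elem q m (xs @ replicate k 0) = shifted_elem q m xs"
proof (induction k)
  case (Suc k)
  have "xs @ replicate (Suc k) 0 = (xs @ replicate k 0) @ [0]"
    by (simp flip: replicate_append_same)
  then show ?case using Suc by (simp only: shifted_elem_append_zero)
qed simp

lemma vars_sym_elem:
  "vars (sym_elem (Cst q) m zs) \<subseteq> (\<Union>z\<in>set zs. vars z)"
proof (induction "Cst q" m zs rule: sym_elem.induct)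
  case (3 m z zs)
  let ?c = "(of_nat (length zs) - of_nat m) * Cst q"
  have c: "?c = Cst ((of_nat (length zs) - of_nat m) * q)" by (simp add: Cst_simps)
  have "vars (z - ?c) \<subseteq> vars z" using vars_diff[of z ?c] unfolding c by simp
  then show ?case
    using 3 vars_mult[of "z - ?c" "sym_elem (Cst q) m zs"]
      vars_add[of "sym_elem (Cst q) (Suc m) zs" "(z - ?c) * sym_elem (Cst q) m zs"]
    unfolding sym_elem.simps list.set UN_insert by blast
qed simp_all

lemma degree_sym_elem:
  assumes "\<And>z. z \<in> set zs \<Longrightarrow> total_degree z \<le> 1"
  shows "total_degree (sym_elem (Cst q) m zs) \<le> m"
  using assms
proof (induction "Cst q" m zs rule: sym_elem.induct)
  case (3 m z zs)
  let ?c = "(of_nat (length zs) - of_nat m) * Cst q"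
  have c: "?c = Cst ((of_nat (length zs) - of_nat m) * q)" by (simp add: Cst_simps)
  have "total_degree (z - ?c) \<le> 1" unfolding c using 3(3) by (intro degree_le_diff) simp_all
  then have "total_degree ((z - ?c) * sym_elem (Cst q) m zs) \<le> 1 + m"
    using 3 by (intro degree_le_mult) simp_all
  then show ?case using 3 by (simp add: degree_le_add)
qed (simp_all add: degree_le_zero)

lemma lookup_eq_zero_of_vars: "i \<notin> vars p \<Longrightarrow> lookup \<alpha> i \<noteq> 0 \<Longrightarrow> lookup p \<alpha> = 0"
  unfolding vars_def by (metis UN_I in_keys_iff)

lemma lookup_single_times:
  fixes p :: "'k::comm_ring_1 mpoly"
  shows "lookup (Poly_Mapping.single \<beta> 1 * p) (\<beta> + \<alpha>) = lookup p \<alpha>"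
  by (induction p rule: poly_mapping_single_induct)
    (simp_all add: distrib_left lookup_add mult_single lookup_single when_def)

text \<open>The monomial of the first \<open>m\<close> variables can arise only from products that contain the first
  variable, so at each stage of the recursion a single summand contributes.\<close>

lemma lookup_top_sym_elem:
  assumes "distinct is" "m \<le> length is"
  shows "lookup (sym_elem (Cst q) m (map (\<lambda>i. Var i - Cst c) is))
      (\<Sum>i\<in>set (take m is). Poly_Mapping.single i 1) = (1 :: 'k::comm_ring_1)"
  using assms
proof (induction m arbitrary: "is")
  case 0
  then show ?case by simp
next
  case (Suc m)
  then obtain i js where is_Cons: "is = i # js" by (cases "is") auto
  let ?z = "map (\<lambda>i. Var i - Cst c) js :: 'k mpoly list"
  let ?\<beta> = "\<Sum>i\<in>set (take m js). Poly_Mapping.single i (1::nat)"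
  let ?\<alpha> = "Poly_Mapping.single i 1 + ?\<beta>"
  let ?c = "Cst c + (of_nat (length js) - of_nat m) * Cst q"
  have c: "?c = Cst (c + (of_nat (length js) - of_nat m) * q)" by (simp add: Cst_simps)
  have i: "i \<notin> set js" using Suc.prems by (simp add: is_Cons)
  then have sum: "(\<Sum>i\<in>set (take (Suc m) is). Poly_Mapping.single i 1) = ?\<alpha>"
    using in_set_takeD[of i m js] by (simp add: is_Cons) (subst sum.insert; auto)
  have "(\<Union>z\<in>set ?z. vars z) \<subseteq> set js"
    using vars_diff[of "Var _ :: 'k mpoly" "Cst c"] by fastforce
  then have novar: "i \<notin> vars (sym_elem (Cst q) k ?z)" for k
    using vars_sym_elem[of q k ?z] i by blast
  then have novar': "i \<notin> vars (?c * sym_elem (Cst q) m ?z)"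
    using vars_mult[of ?c "sym_elem (Cst q) m ?z"] unfolding c by auto
  have \<alpha>: "lookup ?\<alpha> i \<noteq> 0" by (simp add: lookup_add)
  have "sym_elem (Cst q) (Suc m) (map (\<lambda>i. Var i - Cst c) is) = sym_elem (Cst q) (Suc m) ?z
      + (Var i * sym_elem (Cst q) m ?z - ?c * sym_elem (Cst q) m ?z)"
    by (simp add: is_Cons algebra_simps)
  then have "lookup (sym_elem (Cst q) (Suc m) (map (\<lambda>i. Var i - Cst c) is)) ?\<alpha>
      = lookup (Var i * sym_elem (Cst q) m ?z) ?\<alpha>"
    by (simp only: lookup_add lookup_minus lookup_eq_zero_of_vars[OF novar \<alpha>]
        lookup_eq_zero_of_vars[OF novar' \<alpha>]) simp
  also have "\<dots> = lookup (sym_elem (Cst q) m ?z) ?\<beta>"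
    unfolding Var_def by (rule lookup_single_times)
  also have "\<dots> = 1" using Suc.prems by (intro Suc.IH) (simp_all add: is_Cons)
  finally show ?case by (simp only: sum)
qed

section \<open>A polynomial is determined by its values on small partitions\<close>

text \<open>For \<open>s = 1\<close> this is the full symmetric group, with the ordinary size as \<open>weight\<close>; for
  \<open>s = 2\<close> it is the group of parity preserving permutations, with the sum of the odd-indexed parts as
  \<open>weight\<close>.\<close>

definition residue_perms :: "nat \<Rightarrow> nat \<Rightarrow> (nat \<Rightarrow> nat) set" where
  "residue_perms s n = {\<pi>. \<pi> permutes {1..n} \<and> (\<forall>i\<in>{1..n}. \<pi> i mod s = i mod s)}"

definition weight :: "nat \<Rightarrow> nat \<Rightarrow> expo \<Rightarrow> nat" where
  "weight s n \<mu> = (\<Sum>i | i \<in> {1..n} \<and> i mod s = 1 mod s. lookup \<mu> i)"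

text \<open>Reflection \<open>i \<mapsto> n + 1 - i\<close> exchanges the two residue classes.  The equality says that the
  degree of the product of all \<open>z\<^sub>i\<close> with \<open>i \<equiv> n\<close> is the weight of a full column of length \<open>n\<close>.\<close>

lemma card_residue_class:
  fixes s n :: nat
  assumes "0 < s" "1 \<le> n"
  shows "card {i\<in>{1..n}. i mod s = n mod s} = card {i\<in>{1..n}. i mod s = 1 mod s}"
proof (rule bij_betw_same_card)
  let ?A = "{i\<in>{1..n}. i mod s = n mod s}" and ?B = "{i\<in>{1..n}. i mod s = 1 mod s}"
  have *: "i mod s = n mod s \<longleftrightarrow> (n + 1 - i) mod s = 1 mod s" if "i \<in> {1..n}" for i
  proof -
    have "n mod s = i mod s \<longleftrightarrow> s dvd n - i" using that by (intro mod_eq_dvd_iff_nat) simp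
    also have "\<dots> \<longleftrightarrow> s dvd (n + 1 - i) - 1" using that by simp
    also have "\<dots> \<longleftrightarrow> (n + 1 - i) mod s = 1 mod s"
      using that unfolding atLeastAtMost_iff by (intro mod_eq_dvd_iff_nat[symmetric]) linarith
    finally show ?thesis by (simp only: eq_commute[of "i mod s"])
  qed
  have "n + 1 - i \<in> ?B" if "i \<in> ?A" for i
    using that *[of i] by (simp del: One_nat_def) linarith
  moreover have "n + 1 - i \<in> ?A" if "i \<in> ?B" for i
    using that *[of "n + 1 - i"] by (simp del: One_nat_def) linarith
  ultimately show "bij_betw (\<lambda>i. n + 1 - i) ?A ?B"
    by (intro bij_betw_byWitness[where f' = "\<lambda>i. n + 1 - i"] ballI image_subsetI) simp_all
qed

lemma lookup_column: "lookup (column m) i = (if i \<in> {1..m} then 1 else 0)"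
  by (simp add: column_def lookup_sum lookup_single when_def)

lemma lookup_sum_single_one:
  "finite A \<Longrightarrow> lookup (\<Sum>i\<in>A. Poly_Mapping.single i (1::nat)) j = (if j \<in> A then 1 else 0)"
  by (simp add: lookup_sum lookup_single when_def)

lemma keys_column: "keys (column m) = {1..m}"
  by (auto simp: lookup_column in_keys_iff split: if_splits)

lemma subst_const: "subst (\<lambda>i. Cst (x i)) p = Cst (eval x p)"
  by (rule ring_map_eqI[OF ring_map_subst ring_map_comp[OF ring_map_Cst ring_map_eval]]) simp_all

lemma subst_unshift: "subst (\<lambda>i. Var i - Cst c) (subst (\<lambda>i. Var i + Cst c) p) = p"
  by (simp add: subst_subst subst_simps)

lemma invariant_under_shift:
  assumes "invariant_under G p"
  shows "invariant_under G (subst (\<lambda>i. Var i + Cst c) p)"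
  unfolding invariant_under_def
proof
  fix \<pi> assume "\<pi> \<in> G"
  then have "subst (\<lambda>i. Var i + Cst c) p = subst (\<lambda>i. Var i + Cst c) (subst (\<lambda>i. Var (\<pi> i)) p)"
    using assms by (simp add: invariant_under_def)
  also have "\<dots> = subst (\<lambda>i. Var (\<pi> i)) (subst (\<lambda>i. Var i + Cst c) p)"
    by (simp add: subst_subst subst_simps)
  finally show "subst (\<lambda>i. Var (\<pi> i)) (subst (\<lambda>i. Var i + Cst c) p) = subst (\<lambda>i. Var i + Cst c) p"
    by simp
qed

lemma vars_shift: "vars (subst (\<lambda>i. Var i + Cst c) p) \<subseteq> vars p"
  using vars_subst[of "\<lambda>i. Var i + Cst c" p] vars_add[of "Var _" "Cst c"] by fastforce

lemma lookup_subst_var_zero: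
  fixes p :: "'k::comm_ring_1 mpoly"
  assumes "lookup \<alpha> i = 0"
  shows "lookup (subst (Var(i := 0)) p) \<alpha> = lookup p \<alpha>"
proof (induction p rule: poly_mapping_single_induct)
  case zero
  show ?case by (simp add: subst_simps)
next
  case (add p \<beta> c)
  have "lookup (subst (Var(i := 0)) (Poly_Mapping.single \<beta> c)) \<alpha> = lookup (Poly_Mapping.single \<beta> c) \<alpha>"
  proof (cases "i \<in> keys \<beta>")
    case True
    then have "monom_at (Var(i := 0 :: 'k mpoly)) \<beta> = 0"
      unfolding monom_at_def by (intro prod_zero) (auto simp: in_keys_iff zero_power intro!: bexI[of _ i])
    moreover have "\<beta> \<noteq> \<alpha>" using True assms by (auto simp: in_keys_iff)
    ultimately show ?thesis
      by (simp add: subst_def eval_hom_single ring_map_Cst lookup_single)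
  next
    case False
    then have "monom_at (Var(i := 0 :: 'k mpoly)) \<beta> = monom_at Var \<beta>"
      unfolding monom_at_def by (intro prod.cong) auto
    then have "subst (Var(i := 0)) (Poly_Mapping.single \<beta> c) = Cst c * monom_at Var \<beta>"
      by (simp add: subst_def eval_hom_single ring_map_Cst)
    then show ?thesis by (simp add: single_eq_Cst_times_monom)
  qed
  with add show ?case by (simp only: subst_simps lookup_add)
qed

lemma monomial_dvd:
  fixes p :: "'k::comm_ring_1 mpoly"
  assumes "\<And>\<alpha> i. \<alpha> \<in> keys p \<Longrightarrow> lookup \<beta> i \<le> lookup \<alpha> i"
  shows "Poly_Mapping.single \<beta> 1 dvd p"
proof -
  have "Poly_Mapping.single \<beta> 1 * (\<Sum>\<alpha>\<in>keys p. Poly_Mapping.single (\<alpha> - \<beta>) (lookup p \<alpha>))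
      = (\<Sum>\<alpha>\<in>keys p. Poly_Mapping.single (\<beta> + (\<alpha> - \<beta>)) (lookup p \<alpha>))"
    by (simp add: sum_distrib_left mult_single)
  also have "\<dots> = (\<Sum>\<alpha>\<in>keys p. Poly_Mapping.single \<alpha> (lookup p \<alpha>))"
    using assms
    by (intro sum.cong refl arg_cong2[where f = Poly_Mapping.single] poly_mapping_eqI)
      (simp_all add: lookup_add lookup_minus)
  also have "\<dots> = p" by (rule poly_mapping_sum_single)
  finally show ?thesis by (metis dvd_triv_left)
qed

text \<open>The condition on \<open>r\<close> enters here: the coordinates of \<open>\<rho> + \<mu>\<close> at nonzero parts of \<open>\<mu>\<close>
  are invertible, so evaluations at such points can be divided by monomials.\<close>

lemma rho_plus_nat_nonzero:
  fixes r :: "'k::field_char_0"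
  assumes "\<not> negative_rational r" "0 < k"
  shows "rho n r i + of_nat k \<noteq> 0"
proof
  assume eq: "rho n r i + of_nat k = 0"
  show False
  proof (cases "n - i = 0")
    case True
    with eq assms(2) show False by (simp add: rho_def)
  next
    case False
    then have "of_nat (n - i) \<noteq> (0::'k)" by (simp only: of_nat_eq_0_iff) simp
    moreover have "r * of_nat (n - i) = - of_nat k"
      using eq by (simp add: rho_def eq_neg_iff_add_eq_0 mult.commute del: of_nat_diff)
    ultimately have "r = - of_nat k / of_nat (n - i)" by (simp only: nonzero_eq_divide_eq simp_thms)
    also have "\<dots> = of_rat (- of_nat k / of_nat (n - i))"
      by (simp add: of_rat_divide of_rat_minus del: of_nat_diff)
    finally have "r = of_rat (- of_nat k / of_nat (n - i))" .
    moreover have "(- of_nat k / of_nat (n - i) :: rat) < 0"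
      using False assms(2) by (simp add: divide_neg_pos)
    ultimately show False using assms(1) unfolding negative_rational_def by blast
  qed
qed

lemma residue_perms_mono: "\<pi> \<in> residue_perms s n \<Longrightarrow> \<pi> \<in> residue_perms s (Suc n)"
  unfolding residue_perms_def
  using permutes_subset[of \<pi> "{1..n}" "{1..Suc n}"] permutes_not_in[of \<pi> "{1..n}" "Suc n"]
  by (auto simp: le_Suc_eq)

lemma residue_perms_bij:
  assumes "\<pi> \<in> residue_perms s n"
  shows "bij_betw \<pi> {i\<in>{1..n}. i mod s = c} {i\<in>{1..n}. i mod s = c}"
proof -
  let ?A = "{i\<in>{1..n}. i mod s = c}"
  have \<pi>: "\<pi> permutes {1..n}" using assms by (simp add: residue_perms_def)
  then have "\<pi> i \<in> ?A" if "i \<in> ?A" for i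
    using that assms permutes_in_image[OF \<pi>, of i] by (auto simp: residue_perms_def)
  then have "\<pi> ` ?A \<subseteq> ?A" by blast
  moreover have "inj_on \<pi> ?A" using permutes_inj[OF \<pi>] by (rule inj_on_subset) simp
  ultimately show ?thesis by (simp add: bij_betw_def endo_inj_surj)
qed

text \<open>Partitions with \<open>n\<close> parts are partitions with \<open>n + 1\<close> parts whose last part is zero, and on
  the first \<open>n\<close> coordinates the two versions of \<open>\<rho>\<close> differ by the constant \<open>r\<close>.  After translation by
  \<open>r\<close>, the restriction to \<open>z\<^bsub>n+1\<^esub> = 0\<close> is therefore covered by the statement for \<open>n\<close> variables,
  which is the assumption \<open>IH\<close>.\<close>

lemma restrict_last_variable_zero:
  fixes p :: "'k::field_char_0 mpoly"
  assumes p: "p \<in> poly_ring (Suc n)" "invariant_under (residue_perms s (Suc n)) p"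
    "total_degree p \<le> d"
    and van: "\<And>\<mu>. \<mu> \<in> Lam (Suc n) \<Longrightarrow> weight s (Suc n) \<mu> \<le> d \<Longrightarrow> eval_rho (Suc n) r \<mu> p = 0"
    and IH: "\<And>q. q \<in> poly_ring n \<Longrightarrow> invariant_under (residue_perms s n) q \<Longrightarrow> total_degree q \<le> d \<Longrightarrow>
      (\<And>\<mu>. \<mu> \<in> Lam n \<Longrightarrow> weight s n \<mu> \<le> d \<Longrightarrow> eval_rho n r \<mu> q = 0) \<Longrightarrow> q = 0"
  shows "subst (Var(Suc n := 0)) p = 0"
proof -
  \<comment> \<open>Restriction to the last coordinate zero, combined with the translation by \<open>r\<close>.\<close>
  define f where "f = (\<lambda>i. if i = Suc n then 0 else Var i + Cst r :: 'k mpoly)"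
  have f: "subst (\<lambda>i. Var i + Cst r) (subst (Var(Suc n := 0)) q) = subst f q"
    if "vars q \<subseteq> {1..Suc n}" for q
    unfolding subst_subst by (rule subst_cong) (auto simp: f_def subst_simps)
  have varp: "vars p \<subseteq> {1..Suc n}" using p(1) by (simp add: poly_ring_iff)
  have "subst f p = 0"
  proof (rule IH)
    have "vars (f i) \<subseteq> {1..n}" if "i \<in> vars p" for i
    proof (cases "i = Suc n")
      case False
      then have "vars (f i) \<subseteq> {i}" using vars_add[of "Var i" "Cst r"] by (simp add: f_def)
      then show ?thesis using False that varp by force
    qed (simp add: f_def)
    then show "subst f p \<in> poly_ring n" using vars_subst[of f p] unfolding poly_ring_iff by blast
    show "invariant_under (residue_perms s n) (subst f p)"
      unfolding invariant_under_def
    proof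
      fix \<pi> assume \<pi>: "\<pi> \<in> residue_perms s n"
      then have perm: "\<pi> permutes {1..n}" by (simp add: residue_perms_def)
      have "\<pi> (Suc n) = Suc n" using permutes_not_in[OF perm, of "Suc n"] by simp
      then have eq: "\<pi> i = Suc n \<longleftrightarrow> i = Suc n" for i using permutes_inj[OF perm] by (metis injD)
      have "subst (\<lambda>i. Var (\<pi> i)) (subst f p) = subst f (subst (\<lambda>i. Var (\<pi> i)) p)"
        unfolding subst_subst by (rule subst_cong) (simp add: f_def eq subst_simps)
      also have "subst (\<lambda>i. Var (\<pi> i)) p = p"
        using p(2) residue_perms_mono[OF \<pi>] by (simp add: invariant_under_def)
      finally show "subst (\<lambda>i. Var (\<pi> i)) (subst f p) = subst f p" .
    qed
    show "total_degree (subst f p) \<le> d"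
      using p(3) by (intro degree_le_subst) (auto simp: f_def degree_le_zero degree_le_affine simp del: One_nat_def)
    fix \<mu> assume \<mu>: "\<mu> \<in> Lam n" "weight s n \<mu> \<le> d"
    have keys: "keys \<mu> \<subseteq> {1..n}" using \<mu>(1) by (simp add: Lam_def)
    then have last: "lookup \<mu> (Suc n) = 0" by (force simp: in_keys_iff)
    have "\<mu> \<in> Lam (Suc n)" using \<mu>(1) last by (auto simp: Lam_def le_Suc_eq)
    moreover have "weight s (Suc n) \<mu> = weight s n \<mu>" unfolding weight_def
      by (rule sum.mono_neutral_right) (auto simp: le_Suc_eq last)
    ultimately have "eval_rho (Suc n) r \<mu> p = 0" using \<mu>(2) by (intro van) simp_all
    moreover have "eval_rho n r \<mu> (subst f p) = eval_rho (Suc n) r \<mu> p"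
      unfolding eval_rho_def eval_subst
    proof (rule eval_cong)
      fix i assume "i \<in> vars p"
      then have "i \<le> Suc n" using varp by auto
      then show "eval (\<lambda>i. rho n r i + of_nat (lookup \<mu> i)) (f i)
          = rho (Suc n) r i + of_nat (lookup \<mu> i)"
        by (cases "i = Suc n") (auto simp: f_def rho_def last eval_simps Suc_diff_le algebra_simps)
    qed
    ultimately show "eval_rho n r \<mu> (subst f p) = 0" by simp
  qed
  then show ?thesis using subst_unshift[of r "subst (Var(Suc n := 0)) p"] f[OF varp]
    by (simp add: subst_simps)
qed

text \<open>The transposition of \<open>i\<close> and \<open>n\<close> carries the hyperplane \<open>z\<^sub>n = 0\<close> to \<open>z\<^sub>i = 0\<close>.\<close>

lemma restrict_variable_zero:
  fixes p :: "'k::comm_ring_1 mpoly"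
  assumes "invariant_under (residue_perms s n) p" "subst (Var(n := 0)) p = 0"
    "i \<in> {1..n}" "i mod s = n mod s"
  shows "subst (Var(i := 0)) p = 0"
proof -
  define \<tau> where "\<tau> = Transposition.transpose i n"
  have "\<tau> permutes {1..n}" using assms(3) unfolding \<tau>_def by (intro permutes_swap_id) auto
  then have "\<tau> \<in> residue_perms s n"
    using assms(4) by (auto simp: residue_perms_def \<tau>_def Transposition.transpose_def)
  then have "subst (Var(i := 0)) p = subst (Var(i := 0)) (subst (\<lambda>i. Var (\<tau> i)) p)"
    using assms(1) by (simp add: invariant_under_def)
  also have "\<dots> = subst (\<lambda>i. Var (\<tau> i)) (subst (Var(n := 0)) p)"
    unfolding subst_subst
    by (rule subst_cong) (auto simp: \<tau>_def Transposition.transpose_def subst_simps)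
  finally show ?thesis using assms(2) by (simp add: subst_simps)
qed

text \<open>Induction on \<open>n\<close>, and for fixed \<open>n\<close> on \<open>d\<close>: the restriction to \<open>z\<^sub>n = 0\<close> is handled by
  \<open>n - 1\<close>, and the quotient by the product \<open>M\<close> of all \<open>z\<^sub>i\<close> with \<open>i \<equiv> n\<close> by \<open>d - deg M\<close>.\<close>

lemma vanishing_on_small_partitions:
  fixes p :: "'k::field_char_0 mpoly"
  assumes "\<not> negative_rational r" "0 < s"
    and "p \<in> poly_ring n" "invariant_under (residue_perms s n) p" "total_degree p \<le> d"
    and "\<And>\<mu>. \<mu> \<in> Lam n \<Longrightarrow> weight s n \<mu> \<le> d \<Longrightarrow> eval_rho n r \<mu> p = 0"
  shows "p = 0"
  using assms(3-)
proof (induction n arbitrary: p d)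
  case 0
  have "vars p = {}" using 0(1) by (simp add: poly_ring_iff)
  then have "p = Cst (eval x p)" for x
    using subst_cong[of p "\<lambda>i. Cst (x i)" Var] by (simp add: subst_const)
  moreover have "eval_rho 0 r 0 p = 0" using 0(4)[of 0] by (simp add: Lam_def weight_def)
  ultimately show ?case unfolding eval_rho_def by (metis Cst_simps(1))
next
  case (Suc n)
  from Suc.prems show ?case
  proof (induction d arbitrary: p rule: less_induct)
    case (less d)
    define N where "N = Suc n"
    note p = less.prems[folded N_def]
    define A where "A = {i\<in>{1..N}. i mod s = N mod s}"
    define \<beta> :: expo where "\<beta> = (\<Sum>i\<in>A. Poly_Mapping.single i 1)"
    define M :: "'k mpoly" where "M = Poly_Mapping.single \<beta> 1"
    have finA: "finite A" by (simp add: A_def)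
    have M_prod: "M = (\<Prod>i\<in>A. Var i)" by (simp add: M_def \<beta>_def Var_def prod_single_one)
    have lookup_\<beta>: "lookup \<beta> i = (if i \<in> A then 1 else 0)" for i
      unfolding \<beta>_def using finA by (rule lookup_sum_single_one)
    have "N \<in> A" by (simp add: A_def N_def)
    then have card_pos: "0 < card A" using finA by (auto simp: card_gt_0_iff)
    have "keys \<beta> = A" by (auto simp: in_keys_iff lookup_\<beta> split: if_splits)
    then have size_\<beta>: "size_all \<beta> = card A" by (simp add: size_all_def lookup_\<beta>)
    have "subst (Var(Suc n := 0)) p = 0"
      using less.prems(1,2,3,4) Suc.IH by (rule restrict_last_variable_zero)
    then have zero: "subst (Var(i := 0)) p = 0" if "i \<in> A" for i
      using restrict_variable_zero[OF p(2)] that by (simp add: A_def N_def)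
    have "lookup \<beta> i \<le> lookup \<alpha> i" if "\<alpha> \<in> keys p" for \<alpha> i
    proof (cases "i \<in> A")
      case True
      have "lookup \<alpha> i \<noteq> 0"
        using lookup_subst_var_zero[of \<alpha> i p] that zero[OF True] by (auto simp: in_keys_iff)
      then show ?thesis by (simp add: lookup_\<beta>)
    qed (simp add: lookup_\<beta>)
    then have "M dvd p" unfolding M_def by (rule monomial_dvd)
    then obtain g where g: "p = M * g" by (elim dvdE)
    have key: "\<beta> + \<alpha> \<in> keys p" if "\<alpha> \<in> keys g" for \<alpha>
      using that lookup_single_times[of \<beta> g \<alpha>] by (simp add: in_keys_iff g M_def)
    show ?case
    proof (rule ccontr)
      assume "p \<noteq> 0"
      then have "g \<noteq> 0" and "M \<noteq> 0" by (auto simp: g)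
      have key_size: "card A + size_all \<alpha> \<le> d" if "\<alpha> \<in> keys g" for \<alpha>
        using key[OF that] p(3) by (auto simp: total_degree_le_iff size_all_add size_\<beta>)
      obtain \<alpha> where "\<alpha> \<in> keys g" using \<open>g \<noteq> 0\<close> by (metis all_not_in_conv keys_eq_empty)
      then have "card A \<le> d" using key_size by force
      have deg_g: "total_degree g \<le> d - card A"
        using key_size by (force simp: total_degree_le_iff)
      have "keys \<alpha> \<subseteq> {1..N}" if "\<alpha> \<in> keys g" for \<alpha>
      proof -
        have "keys \<alpha> \<subseteq> keys (\<beta> + \<alpha>)" by (auto simp: in_keys_iff lookup_add)
        then show ?thesis using key[OF that] p(1) by (auto simp: poly_ring_def)
      qed
      then have g_ring: "g \<in> poly_ring N" by (auto simp: poly_ring_def)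
      have g_inv: "invariant_under (residue_perms s N) g"
        unfolding invariant_under_def
      proof
        fix \<pi> assume \<pi>: "\<pi> \<in> residue_perms s N"
        have "subst (\<lambda>i. Var (\<pi> i)) M = (\<Prod>i\<in>A. Var (\<pi> i))" by (simp add: M_prod subst_simps)
        also have "\<dots> = M" unfolding M_prod
          using prod.reindex_bij_betw[OF residue_perms_bij[OF \<pi>, of "N mod s"], of Var]
          by (simp add: A_def)
        finally have "M * subst (\<lambda>i. Var (\<pi> i)) g = subst (\<lambda>i. Var (\<pi> i)) p"
          by (simp add: g subst_simps)
        also have "\<dots> = M * g" using p(2) \<pi> by (simp add: invariant_under_def g)
        finally have "M * subst (\<lambda>i. Var (\<pi> i)) g = M * g" .
        then show "subst (\<lambda>i. Var (\<pi> i)) g = g" using \<open>M \<noteq> 0\<close> by simp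
      qed
      have "subst (\<lambda>i. Var i + Cst 1) g = 0"
      proof (rule less.IH[of "d - card A", folded N_def])
        show "d - card A < d" using card_pos \<open>card A \<le> d\<close> by simp
        show "subst (\<lambda>i. Var i + Cst 1) g \<in> poly_ring N"
          using g_ring vars_shift[of 1 g] by (auto simp: poly_ring_iff)
        show "invariant_under (residue_perms s N) (subst (\<lambda>i. Var i + Cst 1) g)"
          by (rule invariant_under_shift[OF g_inv])
        show "total_degree (subst (\<lambda>i. Var i + Cst 1) g) \<le> d - card A"
          by (rule degree_le_subst[OF degree_le_affine deg_g])
        fix \<mu> assume \<mu>: "\<mu> \<in> Lam N" "weight s N \<mu> \<le> d - card A"
        \<comment> \<open>The translation by 1 turns the values of the quotient at \<open>\<mu>\<close> into those at \<open>\<nu>\<close>, all of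
          whose parts are positive, so that \<open>M\<close> does not vanish there.\<close>
        define \<nu> where "\<nu> = \<mu> + column N"
        have "weight s N \<nu> = weight s N \<mu> + card A"
        proof -
          let ?C = "{i\<in>{1..N}. i mod s = 1 mod s}"
          have "weight s N \<nu> = (\<Sum>i\<in>?C. lookup \<mu> i + 1)"
            unfolding weight_def by (rule sum.cong) (auto simp: \<nu>_def lookup_add lookup_column)
          also have "\<dots> = weight s N \<mu> + card ?C"
            by (simp only: sum.distrib weight_def card_eq_sum)
          also have "card ?C = card A"
            using card_residue_class[OF assms(2), of N] by (simp only: A_def N_def)
          finally show ?thesis .
        qed
        moreover have "\<nu> \<in> Lam N"
          using \<mu>(1) keys_add[of \<mu> "column N"]
          by (auto simp: Lam_def \<nu>_def lookup_add lookup_column keys_column)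
        ultimately have "eval_rho N r \<nu> p = 0" using \<mu>(2) \<open>card A \<le> d\<close> by (intro p(4)) simp_all
        moreover have "eval_rho N r \<nu> M \<noteq> 0"
        proof -
          have "rho N r i + of_nat (lookup \<nu> i) \<noteq> 0" if "i \<in> A" for i
            using that by (intro rho_plus_nat_nonzero assms(1))
              (simp add: A_def \<nu>_def lookup_add lookup_column)
          then show ?thesis using finA by (simp add: M_prod eval_rho_def eval_simps)
        qed
        ultimately have "eval_rho N r \<nu> g = 0" by (simp add: g eval_rho_def eval_simps)
        moreover have "eval_rho N r \<mu> (subst (\<lambda>i. Var i + Cst 1) g) = eval_rho N r \<nu> g"
          unfolding eval_rho_def eval_subst
        proof (rule eval_cong)
          fix i assume "i \<in> vars g"
          then have "i \<in> {1..N}" using g_ring by (auto simp: poly_ring_iff)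
          then show "eval (\<lambda>i. rho N r i + of_nat (lookup \<mu> i)) (Var i + Cst 1)
              = rho N r i + of_nat (lookup \<nu> i)"
            by (simp add: eval_simps \<nu>_def lookup_add lookup_column)
        qed
        ultimately show "eval_rho N r \<mu> (subst (\<lambda>i. Var i + Cst 1) g) = 0" by simp
      qed
      then have "g = 0" using subst_unshift[of 1 g] by (simp add: subst_simps)
      with \<open>g \<noteq> 0\<close> show False ..
    qed
  qed
qed

text \<open>The defining conditions of the interpolation polynomial attached to \<open>l\<close>, normalised at the
  monomial \<open>\<beta>\<close>.  Shifted Jack polynomials have \<open>s = 1\<close> and \<open>\<beta> = l\<close>; the semisymmetric ones have
  \<open>s = 2\<close> and \<open>\<beta>\<close> the vector of alternating sums of \<open>l\<close>.\<close>

definition interpolates :: "nat \<Rightarrow> nat \<Rightarrow> expo \<Rightarrow> expo \<Rightarrow> 'k \<Rightarrow> 'k::field_char_0 mpoly \<Rightarrow> bool" where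
  "interpolates s n l \<beta> r p \<longleftrightarrow> p \<in> poly_ring n \<and> invariant_under (residue_perms s n) p \<and>
     total_degree p = weight s n l \<and>
     (\<forall>\<mu>\<in>Lam n. weight s n \<mu> \<le> weight s n l \<and> \<mu> \<noteq> l \<longrightarrow> eval_rho n r \<mu> p = 0) \<and>
     lookup p \<beta> = 1"

lemma lookup_Cst_mult: "lookup (Cst c * p) \<alpha> = c * lookup p \<alpha>"
  by (induction p rule: poly_mapping_single_induct)
    (simp_all add: distrib_left lookup_add Cst_def mult_single lookup_single when_def)

text \<open>A linear combination of two solutions also vanishes at \<open>\<rho> + l\<close>, hence everywhere by
  \<open>vanishing_on_small_partitions\<close>.  A solution cannot itself vanish at \<open>\<rho> + l\<close>, so the combination is
  nontrivial, and comparing coefficients at \<open>\<beta>\<close> gives equality.\<close>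

lemma interpolates_unique:
  fixes p p' :: "'k::field_char_0 mpoly"
  assumes r: "\<not> negative_rational r" "0 < s"
    and p: "interpolates s n l \<beta> r p" and p': "interpolates s n l \<beta> r p'"
  shows "p = p'"
proof -
  define a where "a = eval_rho n r l p"
  define a' where "a' = eval_rho n r l p'"
  define q where "q = Cst a' * p - Cst a * p'"
  have zero: "f = 0" if "f \<in> poly_ring n" "invariant_under (residue_perms s n) f"
      "total_degree f \<le> weight s n l" "eval_rho n r l f = 0"
      "\<And>\<mu>. \<mu> \<in> Lam n \<Longrightarrow> weight s n \<mu> \<le> weight s n l \<Longrightarrow> \<mu> \<noteq> l \<Longrightarrow> eval_rho n r \<mu> f = 0"
    for f :: "'k mpoly"
    by (rule vanishing_on_small_partitions[OF r that(1-3)]) (metis that(4,5))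
  have a: "a' \<noteq> 0"
  proof
    assume "a' = 0"
    then have "p' = 0" using p' by (intro zero) (auto simp: interpolates_def a'_def)
    then show False using p' by (simp add: interpolates_def)
  qed
  have "q = 0"
  proof (rule zero)
    show "q \<in> poly_ring n"
      using p p' vars_diff[of "Cst a' * p" "Cst a * p'"] vars_mult[of "Cst a'" p] vars_mult[of "Cst a" p']
      unfolding interpolates_def poly_ring_iff q_def vars_Cst by blast
    show "invariant_under (residue_perms s n) q"
      using p p' by (simp add: interpolates_def invariant_under_def q_def subst_simps)
    show "total_degree q \<le> weight s n l"
      using p p' degree_le_mult[of "Cst a'" 0 p] degree_le_mult[of "Cst a" 0 p']
      unfolding q_def by (intro degree_le_diff) (auto simp: interpolates_def)
    show "eval_rho n r l q = 0"
      by (simp add: q_def eval_rho_def eval_simps a_def a'_def)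
    show "eval_rho n r \<mu> q = 0" if "\<mu> \<in> Lam n" "weight s n \<mu> \<le> weight s n l" "\<mu> \<noteq> l" for \<mu>
      using p p' that by (simp add: interpolates_def q_def eval_rho_def eval_simps)
  qed
  moreover have "lookup q \<beta> = a' - a"
    using p p' by (simp add: q_def interpolates_def lookup_minus lookup_Cst_mult)
  ultimately have "a = a'" by simp
  with \<open>q = 0\<close> have "Cst a' * (p - p') = 0" by (simp add: q_def algebra_simps)
  moreover have "Cst a' \<noteq> 0" using a by (metis Cst_simps(1) Cst_def lookup_single_eq lookup_zero)
  ultimately show ?thesis by simp
qed

lemma Lam_keys: "\<mu> \<in> Lam n \<Longrightarrow> keys \<mu> \<subseteq> {1..n}"
  unfolding Lam_def by blast

lemma size_all_weight:
  assumes "\<mu> \<in> Lam n"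
  shows "size_all \<mu> = weight 1 n \<mu>"
proof -
  have "size_all \<mu> = sum (lookup \<mu>) {1..n}"
    using Lam_keys[OF assms] by (intro size_all_superset) simp_all
  also have "{1..n} = {i. i \<in> {1..n} \<and> i mod 1 = 1 mod 1}" by auto
  finally show ?thesis unfolding weight_def .
qed

lemma size_odd_weight:
  assumes "\<mu> \<in> Lam n"
  shows "size_odd \<mu> = weight 2 n \<mu>"
  unfolding size_odd_def weight_def
proof (rule sum.mono_neutral_left)
  show "{i \<in> keys \<mu>. odd i} \<subseteq> {i. i \<in> {1..n} \<and> i mod 2 = 1 mod 2}"
    using Lam_keys[OF assms] by (auto simp only: odd_iff_mod_2_eq_one one_mod_two_eq_one)
  show "\<forall>i\<in>{i. i \<in> {1..n} \<and> i mod 2 = 1 mod 2} - {i \<in> keys \<mu>. odd i}. lookup \<mu> i = 0"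
    by (auto simp: odd_iff_mod_2_eq_one in_keys_iff)
qed simp

lemma shifted_jack_eqI:
  assumes "\<not> negative_rational q" "l \<in> Lam N" "interpolates 1 N l l q p"
  shows "shifted_jack N l q = p"
proof -
  have "residue_perms 1 N = Sym_grp N" by (simp add: residue_perms_def Sym_grp_def)
  then have "shifted_jack N l q = (THE p. interpolates 1 N l l q p)"
    using assms(2) unfolding shifted_jack_def interpolates_def
    by (simp add: size_all_weight cong: conj_cong)
  also have "\<dots> = p"
    using assms(3) by (rule the_equality) (rule interpolates_unique[OF assms(1) _ _ assms(3)], simp)
  finally show ?thesis .
qed

lemma semi_jack_eqI:
  assumes "\<not> negative_rational r" "l \<in> Lam n" "interpolates 2 n l (bracket n l) r p"
  shows "semi_jack n l r = p"
proof -
  have "residue_perms 2 n = W_grp n" by (auto simp: residue_perms_def W_grp_def Sym_grp_def)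
  then have "semi_jack n l r = (THE p. interpolates 2 n l (bracket n l) r p)"
    using assms(2) unfolding semi_jack_def interpolates_def
    by (simp add: size_odd_weight cong: conj_cong)
  also have "\<dots> = p"
    using assms(3) by (rule the_equality) (rule interpolates_unique[OF assms(1) _ _ assms(3)], simp)
  finally show ?thesis .
qed

section \<open>Small partitions with a long first column\<close>

lemma sum_le_weight:
  assumes "0 < s" "s * (k - 1) + 1 \<le> n"
  shows "(\<Sum>j<k. lookup \<mu> (s * j + 1)) \<le> weight s n \<mu>"
proof -
  have inj: "inj_on (\<lambda>j. s * j + 1) {..<k}" using assms(1) by (auto simp: inj_on_def)
  have "s * j + 1 \<le> n" if "j < k" for j
  proof -
    have "s * j \<le> s * (k - 1)" using that by (intro mult_le_mono2) simp
    with assms(2) show ?thesis by linarith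
  qed
  then have "(\<lambda>j. s * j + 1) ` {..<k} \<subseteq> {i. i \<in> {1..n} \<and> i mod s = 1 mod s}"
    by (intro image_subsetI CollectI conjI mod_mult_self4) simp
  then have "sum (lookup \<mu>) ((\<lambda>j. s * j + 1) ` {..<k}) \<le> weight s n \<mu>"
    unfolding weight_def by (intro sum_mono2) auto
  then show ?thesis by (simp only: sum.reindex[OF inj] comp_def)
qed

lemma Lam_antimono:
  "\<mu> \<in> Lam n \<Longrightarrow> 1 \<le> i \<Longrightarrow> i \<le> j \<Longrightarrow> j \<le> n \<Longrightarrow> lookup \<mu> j \<le> lookup \<mu> i"
  by (simp add: Lam_def)

text \<open>Since \<open>\<mu>\<close> is decreasing, its parts at the \<open>m\<close> positions \<open>1, s + 1, \<dots>, s(m - 1) + 1\<close> are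
  nonzero.  As they add up to at most \<open>m\<close>, they are all \<open>1\<close>, and no further position congruent to \<open>1\<close>
  can carry a nonzero part.\<close>

lemma small_partition_is_column:
  assumes "0 < s" "1 \<le> m" "\<mu> \<in> Lam n" "weight s n \<mu> \<le> m"
    and j: "s * (m - 1) + 1 \<le> n" "lookup \<mu> (s * (m - 1) + 1) \<noteq> 0"
  obtains t where "\<mu> = column t" "s * (m - 1) + 1 \<le> t" "t \<le> s * m" "t \<le> n"
proof
  let ?S = "{i\<in>{1..n}. lookup \<mu> i \<noteq> 0}"
  let ?t = "Max ?S"
  have fin: "finite ?S" by simp
  have mem: "s * (m - 1) + 1 \<in> ?S" using j by simp
  then show ge: "s * (m - 1) + 1 \<le> ?t" by (intro Max_ge fin)
  have t: "?t \<in> ?S" using mem fin by (intro Max_in) auto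
  then show "?t \<le> n" by simp
  have pos: "1 \<le> lookup \<mu> i" if "1 \<le> i" "i \<le> ?t" for i
    using Lam_antimono[OF assms(3) that] t by simp
  have gt0: "1 \<le> lookup \<mu> (s * k + 1)" if "k < m" for k
  proof (rule pos)
    have "s * k \<le> s * (m - 1)" using that by (intro mult_le_mono2) simp
    with ge show "s * k + 1 \<le> ?t" by linarith
  qed simp
  have "lookup \<mu> 1 + (m - 1) \<le> (\<Sum>k<m. lookup \<mu> (s * k + 1))"
  proof -
    obtain m' where m': "m = Suc m'" using assms(2) by (cases m) auto
    have "(\<Sum>k<m'. 1) \<le> (\<Sum>k<m'. lookup \<mu> (s * Suc k + 1))"
      using gt0 m' by (intro sum_mono) (simp only: Suc_less_eq lessThan_iff)
    then show ?thesis unfolding m' sum.lessThan_Suc_shift by simp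
  qed
  also have "\<dots> \<le> m" using sum_le_weight[OF assms(1) j(1), of \<mu>] assms(4) by simp
  finally have le1: "lookup \<mu> 1 \<le> 1" using assms(2) by simp
  show "?t \<le> s * m"
  proof (rule ccontr)
    assume "\<not> ?t \<le> s * m"
    then have t: "s * m + 1 \<le> ?t" by simp
    have "(\<Sum>k<Suc m. 1) \<le> (\<Sum>k<Suc m. lookup \<mu> (s * k + 1))"
    proof (intro sum_mono pos)
      fix k assume "k \<in> {..<Suc m}"
      then have "s * k \<le> s * m" by (intro mult_le_mono2) simp
      then show "s * k + 1 \<le> ?t" using t by linarith
    qed simp
    also have "\<dots> \<le> m"
      using sum_le_weight[OF assms(1), of "Suc m" n \<mu>] assms(4) t \<open>?t \<le> n\<close> by simp
    finally show False by simp
  qed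
  show "\<mu> = column ?t"
  proof (rule poly_mapping_eqI)
    fix i
    show "lookup \<mu> i = lookup (column ?t) i"
    proof (cases "i \<in> {1..?t}")
      case True
      then have "lookup \<mu> i \<le> lookup \<mu> 1" using \<open>?t \<le> n\<close> by (intro Lam_antimono[OF assms(3)]) auto
      then show ?thesis using True pos[of i] le1 by (simp add: lookup_column)
    next
      case False
      have "lookup \<mu> i = 0"
      proof (rule ccontr)
        assume "lookup \<mu> i \<noteq> 0"
        moreover from this have "i \<in> {1..n}" using Lam_keys[OF assms(3)] by (metis in_keys_iff subsetD)
        ultimately have "i \<in> ?S" by blast
        moreover from this have "i \<le> ?t" by (intro Max_ge fin)
        ultimately show False using False by simp
      qed
      with False show ?thesis by (simp add: lookup_column)
    qed
  qed
qed

lemma column_in_Lam_iff: "column m \<in> Lam n \<longleftrightarrow> m \<le> n"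
proof
  assume "column m \<in> Lam n"
  then have "{1..m} \<subseteq> {1..n}" by (simp add: Lam_def keys_column)
  then show "m \<le> n" by (cases "m = 0") auto
qed (auto simp: Lam_def keys_column lookup_column)

text \<open>The positions congruent to \<open>1\<close> inside the column are \<open>1, s + 1, \<dots>, s(m - 1) + 1\<close>.\<close>

lemma weight_column:
  assumes "0 < s" "s * (m - 1) + 1 \<le> t" "t \<le> s * m" "t \<le> n"
  shows "weight s n (column t) = m"
proof -
  let ?C = "{i. i \<in> {1..n} \<and> i mod s = 1 mod s}" and ?B = "(\<lambda>k. s * k + 1) ` {..<m}"
  have le: "s * k + 1 \<le> t" if "k < m" for k
  proof -
    have "s * k \<le> s * (m - 1)" using that by (intro mult_le_mono2) simp
    then show ?thesis using assms(2) by linarith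
  qed
  have "s * k + 1 \<in> {1..n}" if "k < m" for k using le[OF that] assms(4) by simp
  then have sub: "?B \<subseteq> ?C" by (intro image_subsetI CollectI conjI mod_mult_self4) simp
  have zero: "lookup (column t) i = 0" if i: "i \<in> ?C - ?B" for i
  proof -
    have "s dvd i - 1" using i mod_eq_dvd_iff_nat[of 1 i s] by simp
    then obtain k where "i - 1 = s * k" by (elim dvdE)
    moreover have "1 \<le> i" using i by simp
    ultimately have k: "i = s * k + 1" by linarith
    have "k \<notin> {..<m}" using i unfolding k by blast
    then have "s * m \<le> s * k" by (intro mult_le_mono2) simp
    then have "\<not> i \<le> t" using k assms(3) by linarith
    then show ?thesis by (simp add: lookup_column)
  qed
  have one: "lookup (column t) i = 1" if "i \<in> ?B" for i
    using that le by (auto simp: lookup_column)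
  have "weight s n (column t) = (\<Sum>i\<in>?B. 1)"
    unfolding weight_def using sub zero one by (intro sum.mono_neutral_cong_right) simp_all
  also have "\<dots> = m" using assms(1) by (simp add: card_image inj_on_def)
  finally show ?thesis .
qed

lemma alternating_sum_nat: "(\<Sum>j\<in>{i..i + d}. (- 1) ^ (j - i)) = (if even d then 1 else 0 :: int)"
  by (induction d) simp_all

text \<open>The alternating sum of a run of ones is \<open>1\<close> or \<open>0\<close> according to the parity of its length,
  so the exponent attached to a column is the indicator of every second position, counted from the
  bottom.  For \<open>e = 0\<close> these are the even positions, for \<open>e = 1\<close> the odd ones.\<close>

lemma bracket_column:
  assumes "t = 2 * m - e" "e < 2" "1 \<le> m" "t \<le> n"
  shows "bracket n (column t) = (\<Sum>i\<in>(\<lambda>k. 2 * k - e) ` {1..m}. Poly_Mapping.single i 1)"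
proof (rule poly_mapping_eqI)
  fix i
  let ?c = "\<lambda>i. \<Sum>j\<in>{i..n}. (- 1) ^ (j - i) * int (lookup (column t) j)"
  have c: "?c i = (if i \<le> t \<and> even (t - i) then 1 else 0)" if "1 \<le> i"
  proof -
    have "?c i = (\<Sum>j\<in>{i..t}. (- 1) ^ (j - i))"
      by (rule sum.mono_neutral_cong_right) (use that assms(4) in \<open>auto simp: lookup_column\<close>)
    then show ?thesis using alternating_sum_nat[of i "t - i"] by (cases "i \<le> t") auto
  qed
  have "lookup (bracket n (column t)) i = (if i \<in> {1..n} then nat (?c i) else 0)"
    by (simp add: bracket_def lookup_sum lookup_single when_def)
  also have "\<dots> = (if 1 \<le> i \<and> i \<le> t \<and> even (t - i) then 1 else 0 :: nat)"
    using c assms(4) by auto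
  also have "(1 \<le> i \<and> i \<le> t \<and> even (t - i)) = (i \<in> (\<lambda>k. 2 * k - e) ` {1..m})"
  proof
    assume i: "1 \<le> i \<and> i \<le> t \<and> even (t - i)"
    moreover have "t + e = 2 * m" using assms(1-3) by linarith
    ultimately have "even (i + e)" by presburger
    then obtain k where "i + e = 2 * k" by (elim evenE)
    with i assms(1,2) have "i = 2 * k - e" "1 \<le> k" "k \<le> m" by linarith+
    then have "i = 2 * k - e" "k \<in> {1..m}" by simp_all
    then show "i \<in> (\<lambda>k. 2 * k - e) ` {1..m}" by blast
  next
    assume "i \<in> (\<lambda>k. 2 * k - e) ` {1..m}"
    then obtain k where k: "i = 2 * k - e" "1 \<le> k" "k \<le> m" by auto
    then have "t - i = 2 * (m - k)" using assms(1,2) by linarith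
    then have "even (t - i)" by simp
    moreover have "1 \<le> i" "i \<le> t" using k assms(1,2) by linarith+
    ultimately show "1 \<le> i \<and> i \<le> t \<and> even (t - i)" by blast
  qed
  also have "(if i \<in> (\<lambda>k. 2 * k - e) ` {1..m} then 1 else 0 :: nat)
      = lookup (\<Sum>i\<in>(\<lambda>k. 2 * k - e) ` {1..m}. Poly_Mapping.single i 1) i"
    by (simp only: lookup_sum_single_one[OF finite_imageI[OF finite_atLeastAtMost]])
  finally show "lookup (bracket n (column t)) i
      = lookup (\<Sum>i\<in>(\<lambda>k. 2 * k - e) ` {1..m}. Poly_Mapping.single i 1) i" .
qed

section \<open>The interpolation polynomials of columns\<close>

text \<open>The \<open>m\<close>-th symmetric polynomial in the variables \<open>z\<^bsub>s-e\<^esub>, z\<^bsub>2s-e\<^esub>, \<dots>, z\<^bsub>Ns-e\<^esub>\<close> of one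
  residue class.  Subtracting the last of the corresponding entries of \<open>\<rho>\<close> makes these entries end in \<open>0\<close>, as
  the vector \<open>\<rho>\<close> for \<open>N\<close> variables and parameter \<open>s r\<close> does.\<close>

definition class_poly :: "nat \<Rightarrow> nat \<Rightarrow> nat \<Rightarrow> nat \<Rightarrow> 'k \<Rightarrow> nat \<Rightarrow> 'k::field_char_0 mpoly" where
  "class_poly s e N n r m = sym_elem (Cst (of_nat s * r)) m
     (map (\<lambda>i. Var i - Cst (rho n r (s * N - e))) (map (\<lambda>k. s * k - e) [1..<Suc N]))"

text \<open>Along a residue class modulo \<open>s\<close> the vector \<open>\<rho>\<close> for the parameter \<open>r\<close> is, up to a constant,
  the vector \<open>\<rho>\<close> for the parameter \<open>s r\<close>.\<close>

lemma rho_class: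
  assumes "e < s" "s * N - e \<le> n" "1 \<le> k" "k \<le> N"
  shows "rho n r (s * k - e) = of_nat (N - k) * (of_nat s * r) + rho n r (s * N - e)"
proof -
  have "s \<le> s * k" "s * k \<le> s * N" using assms(3,4) by simp_all
  then have "n - (s * k - e) = (s * N - s * k) + (n - (s * N - e))" using assms(1,2) by linarith
  then have "n - (s * k - e) = (N - k) * s + (n - (s * N - e))"
    by (simp only: diff_mult_distrib2 mult.commute[of "N - k" s])
  then show ?thesis
    unfolding rho_def by (simp only: of_nat_add of_nat_mult distrib_right mult.assoc)
qed

lemma shift_class_poly:
  assumes "e < s" "s * N - e \<le> n"
  shows "shift_rho n r (class_poly s e N n r m)
    = shifted_elem (Cst (of_nat s * r)) m (map (\<lambda>k. Var (s * k - e)) [1..<Suc N])"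
proof -
  let ?S = "subst (\<lambda>i. Cst (rho n r i) + Var i)"
  have *: "?S (Var (s * k - e) - Cst (rho n r (s * N - e)))
      = of_nat (N - k) * Cst (of_nat s * r) + Var (s * k - e)" if "k \<in> set [1..<Suc N]" for k
  proof -
    have "?S (Var (s * k - e) - Cst (rho n r (s * N - e)))
        = Cst (rho n r (s * k - e) - rho n r (s * N - e)) + Var (s * k - e)"
      by (simp add: subst_simps Cst_simps)
    also have "rho n r (s * k - e) - rho n r (s * N - e) = of_nat (N - k) * (of_nat s * r)"
      using that by (simp add: rho_class[OF assms, of k] del: of_nat_diff upt_Suc)
    finally show ?thesis by (simp only: Cst_simps)
  qed
  have "shift_rho n r (class_poly s e N n r m) = sym_elem (Cst (of_nat s * r)) m
      (map (\<lambda>k. of_nat (N - k) * Cst (of_nat s * r) + Var (s * k - e)) [1..<Suc N])"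
    unfolding shift_rho_def class_poly_def ring_map_sym_elem[OF ring_map_subst] subst_Cst
      map_map comp_def using * by (simp only: cong: map_cong)
  then show ?thesis by (simp only: sym_elem_add_rho_upt)
qed

lemma eval_rho_eq: "eval_rho n r \<mu> p = eval (\<lambda>i. of_nat (lookup \<mu> i)) (shift_rho n r p)"
  by (simp add: eval_rho_def shift_rho_def eval_subst eval_simps)

lemma eval_class_poly:
  assumes "e < s" "s * N - e \<le> n"
  shows "eval_rho n r \<mu> (class_poly s e N n r m)
    = shifted_elem (of_nat s * r) m (map (\<lambda>k. of_nat (lookup \<mu> (s * k - e))) [1..<Suc N])"
  by (simp add: eval_rho_eq shift_class_poly[OF assms] ring_map_shifted_elem[OF ring_map_eval] comp_def
      del: upt_Suc)

lemma inj_on_class: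
  assumes "e < s"
  shows "inj_on (\<lambda>k. s * k - e) {1..N :: nat}"
proof (rule inj_onI)
  fix k l assume kl: "k \<in> {1..N}" "l \<in> {1..N}" "s * k - e = s * l - e"
  have "s * 1 \<le> s * k" "s * 1 \<le> s * l" using kl(1,2) by (intro mult_le_mono2; simp)+
  then have "s * k = s * l" using kl(3) assms by linarith
  then show "k = l" using assms by simp
qed

text \<open>The bounds on \<open>N\<close> say that the list exhausts the residue class of \<open>-e\<close> in \<open>{1..n}\<close>; this
  is what makes the symmetric polynomials of the class invariant.\<close>

lemma class_indices:
  assumes "e < s" "s * N - e \<le> n" "n < s * Suc N - e"
  shows "set (map (\<lambda>k. s * k - e) [1..<Suc N]) = {i\<in>{1..n}. i mod s = (s - e) mod s}"
    and "distinct (map (\<lambda>k. s * k - e) [1..<Suc N])"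
proof -
  have le: "s \<le> s * k" if "1 \<le> k" for k using that by simp
  show "distinct (map (\<lambda>k. s * k - e) [1..<Suc N])"
    using inj_on_class[OF assms(1), of N]
    by (simp add: distinct_map atLeastLessThanSuc_atLeastAtMost del: upt_Suc)
  show "set (map (\<lambda>k. s * k - e) [1..<Suc N]) = {i\<in>{1..n}. i mod s = (s - e) mod s}"
  proof (intro equalityI subsetI)
    fix i assume "i \<in> set (map (\<lambda>k. s * k - e) [1..<Suc N])"
    then obtain k where "i = s * k - e" "k \<in> {1..<Suc N}" unfolding set_map set_upt by blast
    then have k: "i = s * k - e" "1 \<le> k" "k \<le> N" by simp_all
    obtain k' where k': "k = Suc k'" using k(2) by (cases k) auto
    have "i = s * k' + (s - e)" using k(1) assms(1) unfolding k' mult_Suc_right by linarith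
    then have "i mod s = (s - e) mod s" by (simp only: mod_mult_self4)
    moreover have "s * k \<le> s * N" using k(3) by simp
    then have "1 \<le> i" "i \<le> n" using k le[of k] assms by linarith+
    ultimately show "i \<in> {i\<in>{1..n}. i mod s = (s - e) mod s}" by simp
  next
    fix i assume i: "i \<in> {i\<in>{1..n}. i mod s = (s - e) mod s}"
    then have "i mod s = (s - e) mod s" and i1: "1 \<le> i" "i \<le> n" by simp_all
    then have "(i + e) mod s = ((s - e) + e) mod s" by (intro mod_add_cong refl)
    then have "s dvd i + e" using assms(1) by (simp add: dvd_eq_mod_eq_0)
    then obtain k where k: "i + e = s * k" by (elim dvdE)
    have "i + e < s * Suc N" using i1(2) assms(3) by linarith
    then have "\<not> s * Suc N \<le> s * k" unfolding k by simp
    then have "\<not> Suc N \<le> k" using mult_le_mono2 by blast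
    then have "k \<le> N" by simp
    moreover have "1 \<le> k" using k i1 by (cases k) simp_all
    ultimately have "k \<in> set [1..<Suc N]" by (simp del: upt_Suc)
    moreover have "i = s * k - e" using k by linarith
    ultimately show "i \<in> set (map (\<lambda>k. s * k - e) [1..<Suc N])" unfolding set_map by blast
  qed
qed

lemma class_poly_invariant:
  assumes "e < s" "s * N - e \<le> n" "n < s * Suc N - e"
  shows "invariant_under (residue_perms s n) (class_poly s e N n r m)"
  unfolding invariant_under_def
proof
  fix \<pi> assume \<pi>: "\<pi> \<in> residue_perms s n"
  define js where "js = map (\<lambda>k. s * k - e) [1..<Suc N]"
  let ?z = "\<lambda>i. Var i - Cst (rho n r (s * N - e))"
  note js = class_indices[OF assms, folded js_def]
  have bij: "bij_betw \<pi> (set js) (set js)" unfolding js(1) by (rule residue_perms_bij[OF \<pi>])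
  then have "image_mset \<pi> (mset_set (set js)) = mset_set (set js)"
    by (metis bij_betw_def image_mset_mset_set)
  then have "mset (map \<pi> js) = mset js" by (simp add: mset_set_set[OF js(2)])
  then have "mset (map ?z (map \<pi> js)) = mset (map ?z js)" by (simp only: mset_map)
  then have "sym_elem (Cst (of_nat s * r)) m (map ?z (map \<pi> js))
      = sym_elem (Cst (of_nat s * r)) m (map ?z js)" by (rule sym_elem_cong_mset)
  moreover have "subst (\<lambda>i. Var (\<pi> i)) (class_poly s e N n r m)
      = sym_elem (Cst (of_nat s * r)) m (map ?z (map \<pi> js))"
    unfolding class_poly_def js_def[symmetric] ring_map_sym_elem[OF ring_map_subst]
    by (simp add: comp_def subst_simps)
  ultimately show "subst (\<lambda>i. Var (\<pi> i)) (class_poly s e N n r m) = class_poly s e N n r m"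
    unfolding class_poly_def js_def[symmetric] by (simp only:)
qed

lemma vars_class_poly:
  assumes "e < s" "s * N - e \<le> n" "n < s * Suc N - e"
  shows "vars (class_poly s e N n r m) \<subseteq> {i\<in>{1..n}. i mod s = (s - e) mod s}"
proof -
  have "vars (Var i - Cst c :: 'a mpoly) \<subseteq> {i}" for i c
    using vars_diff[of "Var i :: 'a mpoly" "Cst c"] by simp
  then have "(\<Union>z\<in>set (map (\<lambda>i. Var i - Cst c :: 'a mpoly) is). vars z) \<subseteq> set is" for c "is"
    unfolding set_map by blast
  then show ?thesis
    unfolding class_poly_def class_indices(1)[OF assms, symmetric]
    by (rule order_trans[OF vars_sym_elem])
qed

lemma degree_class_poly: "total_degree (class_poly s e N n r m) \<le> m"
  unfolding class_poly_def
  by (rule degree_sym_elem) (auto intro!: degree_le_diff degree_le_Var simp del: One_nat_def)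

lemma top_coeff_class_poly:
  assumes "e < s" "s * N - e \<le> n" "n < s * Suc N - e" "m \<le> N"
  shows "lookup (class_poly s e N n r m)
    (\<Sum>i\<in>(\<lambda>k. s * k - e) ` {1..m}. Poly_Mapping.single i 1) = 1"
proof -
  have "take m (map (\<lambda>k. s * k - e) [1..<Suc N]) = map (\<lambda>k. s * k - e) [1..<Suc m]"
    using assms(4) by (simp add: take_map take_upt del: upt_Suc)
  then have "set (take m (map (\<lambda>k. s * k - e) [1..<Suc N])) = (\<lambda>k. s * k - e) ` {1..m}"
    by (simp add: atLeastLessThanSuc_atLeastAtMost del: upt_Suc)
  then show ?thesis
    using lookup_top_sym_elem[OF class_indices(2)[OF assms(1-3)], of m "of_nat s * r"] assms(4)
    unfolding class_poly_def by (simp del: upt_Suc)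
qed

lemma size_top:
  assumes "e < s"
  shows "size_all (\<Sum>i\<in>(\<lambda>k. s * k - e) ` {1..m}. Poly_Mapping.single i 1) = m"
proof -
  let ?I = "(\<lambda>k. s * k - e) ` {1..m}"
  have "card ?I = card {1..m}" by (rule card_image[OF inj_on_class[OF assms]])
  then have "card ?I = m" by simp
  let ?\<beta> = "\<Sum>i\<in>?I. Poly_Mapping.single i (1::nat)"
  have lookup: "lookup ?\<beta> i = (if i \<in> ?I then 1 else 0)" for i
    by (rule lookup_sum_single_one) simp
  have "keys ?\<beta> \<subseteq> ?I"
  proof
    fix i assume "i \<in> keys ?\<beta>"
    then have "lookup ?\<beta> i \<noteq> 0" by (rule in_keys_iff[THEN iffD1])
    then have "(if i \<in> ?I then 1 else 0 :: nat) \<noteq> 0" unfolding lookup .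
    then show "i \<in> ?I" by (rule contrapos_np) (simp only: if_False)
  qed
  then have "size_all ?\<beta> = (\<Sum>i\<in>?I. lookup ?\<beta> i)" by (intro size_all_superset) simp_all
  also have "\<dots> = (\<Sum>i\<in>?I. 1)" unfolding lookup by (rule sum.cong) simp_all
  also have "\<dots> = m" using \<open>card ?I = m\<close> by (simp only: card_eq_sum)
  finally show ?thesis .
qed

lemma total_degree_eqI:
  assumes "total_degree p \<le> d" "lookup p \<beta> = 1" "size_all \<beta> = d"
  shows "total_degree (p :: 'k::field_char_0 mpoly) = d"
proof -
  have "\<beta> \<in> keys p" using assms(2) by (simp add: in_keys_iff)
  then show ?thesis using assms total_degree_le_iff[of p "total_degree p"] by force
qed

lemma map_upt_zero_tail:
  assumes "1 \<le> m" "m \<le> Suc N" "\<And>k. m \<le> k \<Longrightarrow> k \<le> N \<Longrightarrow> x k = 0"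
  shows "map x [1..<Suc N] = map x [1..<m] @ replicate (Suc N - m) 0"
proof -
  have "[1..<Suc N] = [1..<m] @ [m..<Suc N]"
    using assms(1,2) upt_add_eq_append[of 1 m "Suc N - m"] by (simp del: upt_Suc)
  moreover have "map x [m..<Suc N] = replicate (Suc N - m) 0"
    using assms(3) by (intro nth_equalityI) (simp_all del: upt_Suc)
  ultimately show ?thesis by (simp del: upt_Suc)
qed

lemma shifted_elem_few_nonzero:
  assumes "1 \<le> m" "\<And>k. m \<le> k \<Longrightarrow> k \<le> N \<Longrightarrow> x k = 0"
  shows "shifted_elem q m (map x [1..<Suc N]) = 0"
proof (cases "m \<le> N")
  case True
  have "map x [1..<Suc N] = map x [1..<m] @ replicate (Suc N - m) 0"
    using True by (intro map_upt_zero_tail assms) simp_all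
  moreover have "shifted_elem q m (map x [1..<m]) = 0"
    using assms(1) by (intro shifted_elem_too_long) simp
  ultimately show ?thesis by (simp only: shifted_elem_append_zeros)
qed (simp add: shifted_elem_too_long del: upt_Suc)

text \<open>Since \<open>\<mu>\<close> is decreasing, it has fewer than \<open>m\<close> nonzero parts in the residue class, all of
  them at its first positions.\<close>

lemma eval_class_poly_zero:
  assumes "e < s" "s * N - e \<le> n" "\<mu> \<in> Lam n" "1 \<le> m" "lookup \<mu> (s * m - e) = 0"
  shows "eval_rho n r \<mu> (class_poly s e N n r m) = 0"
  unfolding eval_class_poly[OF assms(1,2)]
proof (rule shifted_elem_few_nonzero[OF assms(4)])
  fix k assume k: "m \<le> k" "k \<le> N"
  have "s * m \<le> s * k" "s * k \<le> s * N" "s \<le> s * m" using k assms(4) by simp_all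
  then have "lookup \<mu> (s * k - e) \<le> lookup \<mu> (s * m - e)"
    using assms(1,2) by (intro Lam_antimono[OF assms(3)]) linarith+
  then show "of_nat (lookup \<mu> (s * k - e)) = 0" using assms(5) by simp
qed

text \<open>The value does not depend on \<open>e\<close>, \<open>N\<close> and \<open>n\<close>: restricted to any residue class, the column
  consists of \<open>m\<close> ones followed by zeros, and the zeros do not matter.\<close>

lemma eval_class_poly_column:
  fixes r :: "'k::field_char_0"
  assumes "e < s" "s * N - e \<le> n" "1 \<le> m" "m \<le> N"
  shows "eval_rho n r (column (s * m)) (class_poly s e N n r m)
    = shifted_elem (of_nat s * r) m (replicate m 1)"
proof -
  let ?x = "\<lambda>k. of_nat (lookup (column (s * m)) (s * k - e)) :: 'k"
  have one: "?x k = 1" if "1 \<le> k" "k \<le> m" for k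
  proof -
    have "s \<le> s * k" "s * k \<le> s * m" using that by simp_all
    then have "1 \<le> s * k - e" "s * k - e \<le> s * m" using assms(1) by linarith+
    then show ?thesis by (simp add: lookup_column)
  qed
  have "?x k = 0" if "Suc m \<le> k" for k
  proof -
    have "s * Suc m \<le> s * k" using that by (intro mult_le_mono2)
    then have "s * m < s * k - e" using assms(1) by simp
    then show ?thesis by (simp add: lookup_column)
  qed
  then have "map ?x [1..<Suc N] = map ?x [1..<Suc m] @ replicate (Suc N - Suc m) 0"
    using assms(4) by (intro map_upt_zero_tail) simp_all
  also have "map ?x [1..<Suc m] = replicate m 1"
  proof -
    have "map ?x [1..<Suc m] = map (\<lambda>_. 1) [1..<Suc m]"
      using one by (intro map_cong refl) (simp del: upt_Suc)
    then show ?thesis by (simp add: map_replicate_const del: upt_Suc)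
  qed
  finally show ?thesis
    by (simp only: eval_class_poly[OF assms(1,2)] shifted_elem_append_zeros)
qed

text \<open>If \<open>m > N\<close>, both sides are zero: the left one by convention, the right one because there is no
  index set of \<open>m\<close> elements.\<close>

lemma shifted_jack_tilde_column:
  fixes q :: "'k::field_char_0"
  assumes "\<not> negative_rational q" "1 \<le> m"
  shows "shifted_jack_tilde N (column m) q = shifted_elem (Cst q) m (map Var [1..<Suc N])"
proof (cases "m \<le> N")
  case False
  then show ?thesis
    by (simp add: shifted_jack_tilde_def column_in_Lam_iff shifted_elem_too_long del: upt_Suc)
next
  case True
  let ?p = "class_poly 1 0 N N q m"
  have side: "0 < (1::nat)" "1 * N - 0 \<le> N" "N < 1 * Suc N - 0" by simp_all
  have w: "weight 1 N (column m) = m" using True assms(2) by (intro weight_column) simp_all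
  have top: "lookup ?p (column m) = 1"
    using top_coeff_class_poly[OF side True, of q] by (simp add: column_def)
  have "interpolates 1 N (column m) (column m) q ?p"
    unfolding interpolates_def w
  proof (intro conjI ballI impI top)
    show "?p \<in> poly_ring N" using vars_class_poly[OF side, of q m] unfolding poly_ring_iff by blast
    show "invariant_under (residue_perms 1 N) ?p" by (rule class_poly_invariant[OF side])
    show "total_degree ?p = m"
      using degree_class_poly top size_top[of 0 1 m]
      by (intro total_degree_eqI) (simp_all add: column_def)
    fix \<mu> assume \<mu>: "\<mu> \<in> Lam N" "weight 1 N \<mu> \<le> m \<and> \<mu> \<noteq> column m"
    have "lookup \<mu> m = 0"
    proof (rule ccontr)
      assume ne: "lookup \<mu> m \<noteq> 0"
      have m: "1 * (m - 1) + 1 = m" using assms(2) by simp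
      obtain t where "\<mu> = column t" "m \<le> t" "t \<le> 1 * m"
        by (rule small_partition_is_column[OF zero_less_one assms(2) \<mu>(1), unfolded m])
          (use \<mu>(2) True ne in blast)+
      then show False using \<mu>(2) assms(2) by simp
    qed
    then show "eval_rho N q \<mu> ?p = 0"
      using \<mu>(1) assms(2) by (intro eval_class_poly_zero) simp_all
  qed
  then have "shifted_jack N (column m) q = ?p"
    using assms(1) True by (intro shifted_jack_eqI) (simp_all add: column_in_Lam_iff)
  then show ?thesis
    using True shift_class_poly[OF side(1,2), of q m]
    by (simp add: shifted_jack_tilde_def column_in_Lam_iff del: upt_Suc)
qed

lemma at_odd_shifted_jack_tilde_column:
  fixes r :: "'k::field_char_0"
  assumes "\<not> negative_rational (2 * r)" "1 \<le> m" "2 * N - 1 \<le> n"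
  shows "at_odd (shifted_jack_tilde N (column m) (2 * r)) = shift_rho n r (class_poly 2 1 N n r m)"
  using assms(3)
  by (simp add: shifted_jack_tilde_column[OF assms(1,2)] at_odd_def ring_map_shifted_elem[OF ring_map_subst]
      shift_class_poly comp_def del: upt_Suc)

lemma at_even_shifted_jack_tilde_column:
  fixes r :: "'k::field_char_0"
  assumes "\<not> negative_rational (2 * r)" "1 \<le> m" "2 * N \<le> n"
  shows "at_even (shifted_jack_tilde N (column m) (2 * r)) = shift_rho n r (class_poly 2 0 N n r m)"
  using assms(3)
  by (simp add: shifted_jack_tilde_column[OF assms(1,2)] at_even_def ring_map_shifted_elem[OF ring_map_subst]
      shift_class_poly comp_def del: upt_Suc)

text \<open>The only column of length \<open>2m - 1\<close> or \<open>2m\<close> with a nonzero entry at position \<open>2m\<close> is the one that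
  is exempted from the vanishing condition.\<close>

lemma semi_jack_even_column:
  fixes r :: "'k::field_char_0"
  assumes r: "\<not> negative_rational r" and m: "1 \<le> m" "2 * m \<le> n"
  shows "semi_jack n (column (2 * m)) r = class_poly 2 0 (n div 2) n r m"
proof (rule semi_jack_eqI[OF r])
  let ?p = "class_poly 2 0 (n div 2) n r m"
  show "column (2 * m) \<in> Lam n" using m by (simp add: column_in_Lam_iff)
  have side: "0 < (2::nat)" "2 * (n div 2) - 0 \<le> n" "n < 2 * Suc (n div 2) - 0" by simp_all
  have w: "weight 2 n (column (2 * m)) = m" using m by (intro weight_column) simp_all
  have b: "bracket n (column (2 * m)) = (\<Sum>i\<in>(\<lambda>k. 2 * k - 0) ` {1..m}. Poly_Mapping.single i 1)"
    using m by (intro bracket_column) simp_all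
  have "m \<le> n div 2" using m by simp
  then have top: "lookup ?p (bracket n (column (2 * m))) = 1"
    unfolding b by (rule top_coeff_class_poly[OF side])
  show "interpolates 2 n (column (2 * m)) (bracket n (column (2 * m))) r ?p"
    unfolding interpolates_def w
  proof (intro conjI ballI impI top)
    show "?p \<in> poly_ring n" using vars_class_poly[OF side, of r m] unfolding poly_ring_iff by blast
    show "invariant_under (residue_perms 2 n) ?p" by (rule class_poly_invariant[OF side])
    show "total_degree ?p = m"
      using degree_class_poly top size_top[OF side(1), of m] unfolding b by (rule total_degree_eqI)
    fix \<mu> assume \<mu>: "\<mu> \<in> Lam n" "weight 2 n \<mu> \<le> m \<and> \<mu> \<noteq> column (2 * m)"
    have "lookup \<mu> (2 * m) = 0"
    proof (rule ccontr)
      assume ne: "lookup \<mu> (2 * m) \<noteq> 0"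
      have j: "2 * (m - 1) + 1 \<le> n" using m by linarith
      have "lookup \<mu> (2 * m) \<le> lookup \<mu> (2 * (m - 1) + 1)"
        using m by (intro Lam_antimono[OF \<mu>(1)]) linarith+
      then have "lookup \<mu> (2 * (m - 1) + 1) \<noteq> 0" using ne by linarith
      then obtain t where t: "\<mu> = column t" "t \<le> 2 * m"
        using small_partition_is_column[OF side(1) m(1) \<mu>(1) _ j] \<mu>(2) by blast
      with ne have "t = 2 * m" by (auto simp: lookup_column split: if_splits)
      with t \<mu>(2) show False by simp
    qed
    then show "eval_rho n r \<mu> ?p = 0"
      using \<mu>(1) m side by (intro eval_class_poly_zero) simp_all
  qed
qed

text \<open>At \<open>(1\<^bsup>2m\<^esup>)\<close> neither polynomial need vanish, but their values agree; at the other relevant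
  partitions both are zero.  The subtracted polynomial does not affect the normalisation, as it
  contains no variable with an odd index.\<close>

lemma semi_jack_odd_column:
  fixes r :: "'k::field_char_0"
  assumes r: "\<not> negative_rational r" and m: "1 \<le> m" "2 * m - 1 \<le> n"
  shows "semi_jack n (column (2 * m - 1)) r
    = class_poly 2 1 ((n + 1) div 2) n r m - class_poly 2 0 (n div 2) n r m"
proof (rule semi_jack_eqI[OF r])
  let ?po = "class_poly 2 1 ((n + 1) div 2) n r m" and ?pe = "class_poly 2 0 (n div 2) n r m"
  show "column (2 * m - 1) \<in> Lam n" using m by (simp add: column_in_Lam_iff)
  have e: "0 < (2::nat)" "2 * (n div 2) - 0 \<le> n" "n < 2 * Suc (n div 2) - 0" by simp_all
  have o: "1 < (2::nat)" "2 * ((n + 1) div 2) - 1 \<le> n" "n < 2 * Suc ((n + 1) div 2) - 1"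
    by (simp, presburger+)
  have j: "2 * m - 1 = 2 * (m - 1) + 1" using m by linarith
  have w: "weight 2 n (column (2 * m - 1)) = m" using m by (intro weight_column) linarith+
  have b: "bracket n (column (2 * m - 1)) = (\<Sum>i\<in>(\<lambda>k. 2 * k - 1) ` {1..m}. Poly_Mapping.single i 1)"
    using m by (intro bracket_column) simp_all
  have "m \<le> (n + 1) div 2" using m by linarith
  then have "lookup ?po (bracket n (column (2 * m - 1))) = 1"
    unfolding b by (rule top_coeff_class_poly[OF o])
  moreover have "lookup ?pe (bracket n (column (2 * m - 1))) = 0"
  proof (rule lookup_eq_zero_of_vars)
    show "1 \<notin> vars ?pe" using vars_class_poly[OF e] by force
    have "1 \<in> (\<lambda>k. 2 * k - 1) ` {1..m}" using m by (intro image_eqI[of _ _ 1]) simp_all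
    then show "lookup (bracket n (column (2 * m - 1))) 1 \<noteq> 0"
      unfolding b by (subst lookup_sum_single_one) simp_all
  qed
  ultimately have top: "lookup (?po - ?pe) (bracket n (column (2 * m - 1))) = 1"
    by (simp add: lookup_minus)
  show "interpolates 2 n (column (2 * m - 1)) (bracket n (column (2 * m - 1))) r (?po - ?pe)"
    unfolding interpolates_def w
  proof (intro conjI ballI impI top)
    show "?po - ?pe \<in> poly_ring n"
      using vars_class_poly[OF o, of r m] vars_class_poly[OF e, of r m] vars_diff[of ?po ?pe]
      unfolding poly_ring_iff by blast
    show "invariant_under (residue_perms 2 n) (?po - ?pe)"
      using class_poly_invariant[OF o, of r m] class_poly_invariant[OF e, of r m]
      by (simp add: invariant_under_def subst_simps)
    have "total_degree (?po - ?pe) \<le> m" by (intro degree_le_diff degree_class_poly)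
    then show "total_degree (?po - ?pe) = m"
      using top size_top[OF o(1), of m] unfolding b by (rule total_degree_eqI)
    fix \<mu> assume \<mu>: "\<mu> \<in> Lam n" "weight 2 n \<mu> \<le> m \<and> \<mu> \<noteq> column (2 * m - 1)"
    have "eval_rho n r \<mu> ?po = eval_rho n r \<mu> ?pe"
    proof (cases "lookup \<mu> (2 * m - 1) = 0")
      case True
      have "lookup \<mu> (2 * m) = 0"
      proof (cases "2 * m \<le> n")
        case le: True
        have "lookup \<mu> (2 * m) \<le> lookup \<mu> (2 * m - 1)"
          using m le by (intro Lam_antimono[OF \<mu>(1)]) linarith+
        then show ?thesis using True by simp
      next
        case False
        then show ?thesis using Lam_keys[OF \<mu>(1)] by (auto simp flip: not_in_keys_iff_lookup_eq_zero)
      qed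
      then have "eval_rho n r \<mu> ?pe = 0" using \<mu>(1) m e by (intro eval_class_poly_zero) simp_all
      moreover have "eval_rho n r \<mu> ?po = 0"
        using \<mu>(1) m(1) o True by (intro eval_class_poly_zero)
      ultimately show ?thesis by simp
    next
      case False
      then obtain t where t: "\<mu> = column t" "2 * m - 1 \<le> t" "t \<le> 2 * m" "t \<le> n"
        using small_partition_is_column[OF e(1) m(1) \<mu>(1), folded j] m(2) \<mu>(2) by blast
      with \<mu>(2) have "t \<noteq> 2 * m - 1" by blast
      with t have t2: "t = 2 * m" by linarith
      then have "m \<le> n div 2" "m \<le> (n + 1) div 2" using t by linarith+
      then show ?thesis
        unfolding t(1) t2 using m(1) by (simp only: eval_class_poly_column[OF o(1,2)]
            eval_class_poly_column[OF e(1,2)])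
    qed
    then show "eval_rho n r \<mu> (?po - ?pe) = 0" by (simp add: eval_rho_def eval_simps)
  qed
qed

lemma negative_rational_half: "negative_rational (2 * r) \<Longrightarrow> negative_rational r"
proof -
  assume "negative_rational (2 * r)"
  then obtain a :: rat where a: "a < 0" "2 * r = of_rat a" by (auto simp: negative_rational_def)
  have "r = of_rat (a / 2)" by (simp add: of_rat_divide flip: a(2))
  moreover have "a / 2 < 0" using a by simp
  ultimately show ?thesis unfolding negative_rational_def by blast
qed

theorem corollary2p8:
  fixes r :: "'k::field_char_0" and n :: nat
  assumes "1 \<le> n"
    and "\<not> negative_rational r"
  shows "(\<forall>m\<ge>1. 2 * m - 1 \<le> n \<longrightarrow>
           semi_jack_tilde n (column (2 * m - 1)) r =
             at_odd (shifted_jack_tilde ((n + 1) div 2) (column m) (2 * r))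
             - at_even (shifted_jack_tilde (n div 2) (column m) (2 * r))) \<and>
         (\<forall>m\<ge>1. 2 * m \<le> n \<longrightarrow>
           semi_jack_tilde n (column (2 * m)) r =
             at_even (shifted_jack_tilde (n div 2) (column m) (2 * r)))"
proof -
  have r2: "\<not> negative_rational (2 * r)" using assms(2) negative_rational_half by blast
  have odd: "at_odd (shifted_jack_tilde ((n + 1) div 2) (column m) (2 * r))
      = shift_rho n r (class_poly 2 1 ((n + 1) div 2) n r m)" if "1 \<le> m" for m
    by (rule at_odd_shifted_jack_tilde_column[OF r2 that]) linarith
  have even: "at_even (shifted_jack_tilde (n div 2) (column m) (2 * r))
      = shift_rho n r (class_poly 2 0 (n div 2) n r m)" if "1 \<le> m" for m
    by (rule at_even_shifted_jack_tilde_column[OF r2 that]) simp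
  show ?thesis
    by (auto simp: semi_jack_tilde_def odd even semi_jack_odd_column[OF assms(2)]
        semi_jack_even_column[OF assms(2)] shift_rho_def subst_simps simp del: One_nat_def)
qed

end
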